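(* Let $B_0$ be a finite, continuous measure on $\mathbb{R}$ with $B_0(\mathbb{R})=\gamma$, and let $c>0$. Let $(\omega_i)_{i\ge1}$ be i.i.d. with distribution $B_0/\gamma$, and let $\Gamma_i=E_1+\cdots+E_i$, where $(E_i)_{i\ge1}$ are i.i.d. exponential random variables with mean $1$, independent of $(\omega_i)_{i\ge1}$. For $n>\gamma$ and $x\in(0,1)$ define $$\mu_n(x)=\frac{\Gamma(c)}{\Gamma(c\gamma/n)\,\Gamma(c-c\gamma/n)}\int_x^1 s^{c\gamma/n-1}(1-s)^{c(1-\gamma/n)-1}\,ds,$$ and define $\mu(x)=c\gamma\int_x^1 s^{-1}(1-s)^{c-1}\,ds$. Then, as $n\to\infty$, $$B_n=\sum_{i=1}^n \mu_n^{-1}\!\left(\frac{\Gamma_i}{\Gamma_{n+1}}\right)\delta_{\omega_i}\;\overset{a.s.}{\longrightarrow}\; B=\sum_{i=1}^\infty \mu^{-1}(\Gamma_i)\,\delta_{\omega_i},$$ where almost sure convergence is vague convergence of measures on $\mathbb{R}$ for almost every realization. The limit $B$ is distributed as the beta process $BP(c,B_0)$. *)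

theory Defs
  imports "HOL-Probability.Probability"
begin

definition compact_supp :: "(real \<Rightarrow> real) \<Rightarrow> bool" where
  "compact_supp f \<longleftrightarrow> compact (closure {x. f x \<noteq> 0})"

definition vague_conv :: "(nat \<Rightarrow> real measure) \<Rightarrow> real measure \<Rightarrow> bool" where
  "vague_conv Ms M \<longleftrightarrow>
     (\<forall>f. continuous_on UNIV f \<and> compact_supp f \<longrightarrow>
        (\<lambda>n. integral\<^sup>L (Ms n) f) \<longlonglongrightarrow> integral\<^sup>L M f)"

definition mu_n :: "real \<Rightarrow> real \<Rightarrow> nat \<Rightarrow> real \<Rightarrow> real" where
  "mu_n c \<gamma> n x =
     Gamma c / (Gamma (c * \<gamma> / real n) * Gamma (c - c * \<gamma> / real n)) *
     (LBINT s=x..1. s powr (c * \<gamma> / real n - 1) * (1 - s) powr (c * (1 - \<gamma> / real n) - 1))"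

definition mu_lim :: "real \<Rightarrow> real \<Rightarrow> real \<Rightarrow> real" where
  "mu_lim c \<gamma> x = c * \<gamma> * (LBINT s=x..1. s powr (-1) * (1 - s) powr (c - 1))"

text \<open>Partial sums Gamma_{i+1} = E_0 + ... + E_i (0-based indexing).\<close>
definition Gam :: "(nat \<Rightarrow> 'a \<Rightarrow> real) \<Rightarrow> nat \<Rightarrow> 'a \<Rightarrow> real" where
  "Gam E i x = (\<Sum>j\<le>i. E j x)"

definition atom_measure :: "(nat \<Rightarrow> real) \<Rightarrow> (nat \<Rightarrow> real) \<Rightarrow> real measure" where
  "atom_measure w p = distr (density (count_space UNIV) (\<lambda>i. ennreal (w i))) borel p"

text \<open>Beta process BP(c, B0) (Hjort): a completely random measure without fixed atoms
  and without drift, with Levy measure c s^(-1) (1-s)^(c-1) ds B0(d omega) on (0,1) x R.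
  Its law is characterised by independence of the masses of disjoint Borel sets and the
  Laplace transforms of the masses B(A).\<close>
definition beta_process :: "'a measure \<Rightarrow> real \<Rightarrow> real measure \<Rightarrow> ('a \<Rightarrow> real measure) \<Rightarrow> bool" where
  "beta_process M c B0 B \<longleftrightarrow>
     prob_space M \<and>
     (\<forall>x\<in>space M. sets (B x) = sets borel) \<and>
     (\<forall>A\<in>sets borel. AE x in M. emeasure (B x) A < \<infinity>) \<and>
     (\<forall>(I::nat set) Aset. finite I \<longrightarrow> disjoint_family_on Aset I \<longrightarrow> (\<forall>i\<in>I. Aset i \<in> sets borel) \<longrightarrow>
        prob_space.indep_vars M (\<lambda>_. borel) (\<lambda>i x. measure (B x) (Aset i)) I) \<and>
     (\<forall>A\<in>sets borel. \<forall>t::real. t \<ge> 0 \<longrightarrow>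
        (\<integral>x. exp (- t * measure (B x) A) \<partial>M) =
        exp (- measure B0 A *
          (LBINT s=0..1. (1 - exp (- t * s)) * c * s powr (-1) * (1 - s) powr (c - 1))))"

end

theory Submission
  imports Defs
begin

text \<open>
  Convergence: n times \<^const>\<open>mu_n\<close> converges pointwise to \<^const>\<open>mu_lim\<close> and is bounded, uniformly in
  n, by an affine function of - ln x. As the n-th arrival time divided by n tends to 1, each atom
  of the n-th measure converges to the corresponding atom of the limit, and the i-th atom is at
  most C q^i with q < 1 for all large n. Dominated convergence of the atom series gives vague
  convergence.

  Law of the limit: let h(s) be the mean of exp (- w tau(omega)), where w = mu_inv s and tau is a
  simple function with values t_j on disjoint sets A_j, and let V(s) = exp (- integral of 1 - h over
  (s, infinity)). For a standard exponential time e one has V(s) = E[h(s + e) V(s + e)]. Hence the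
  product of the factors exp (- w_i tau(omega_i)) over the first n atoms, times V at the n-th
  arrival time, has constant expectation V(0). Letting n tend to infinity yields the joint Laplace transform of the
  masses of the A_j, without conditioning on the number of arrivals. It factorises, so the mixed
  moments of the variables exp (- B(A_j)), which take values in the unit interval, factorise, and
  polynomial approximation in one coordinate at a time gives independence.
\<close>

section \<open>Tail integrals of positive densities and their inverses\<close>

text \<open>No inverse occurring here is explicit. Since tails are strictly decreasing, y < inverse
  r holds iff r < tail y, so limits of inverses are read off from tails at fixed points y. The
  factor n in front of \<open>mu_n\<close> comes from the pole of Gamma at 0: the normalising
  constant behaves like c * \<gamma> / n, while the integrable singularity with exponent c *
  \<gamma> / n - 1 degenerates to the nonintegrable 1 / s. The latter integrates to a logarithm,
  which is the origin of the affine bound in - ln x; inverting that bound yields the geometric decay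
  of the atoms. The identity for V is the equation V' = (1 - h) V in integrated form: it makes - exp
  (- r) V(s + r) a primitive of exp (- r) h(s + r) V(s + r). The variables exp (- B(A_j)) are chosen
  because their mixed moments are joint Laplace transforms at integer arguments.\<close>

locale tail_density =
  fixes f :: "real \<Rightarrow> real"
  assumes cont: "continuous_on {0<..<1} f"
    and pos: "\<And>s. 0 < s \<Longrightarrow> s < 1 \<Longrightarrow> 0 < f s"
    and int: "\<And>x. 0 < x \<Longrightarrow> x < 1 \<Longrightarrow> set_integrable lborel {x<..<1} f"
begin

definition T :: "real \<Rightarrow> real" where "T x = (LBINT s=x..1. f s)"

lemma T_eq_set_integral: "x < 1 \<Longrightarrow> T x = (LBINT s:{x<..<1}. f s)"
  unfolding T_def one_ereal_def by (subst interval_integral_Ioo) auto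

lemma T_eq_antideriv:
  "\<exists>F K. \<forall>x\<in>{0<..<1}. T x = K - F x \<and> (F has_real_derivative f x) (at x)"
proof -
  have "\<exists>F. \<forall>x :: real. 0 < ereal x \<longrightarrow> ereal x < 1 \<longrightarrow> (F has_vector_derivative f x) (at x)"
    by (rule einterval_antiderivative)
      (use cont in \<open>auto simp: continuous_on_eq_continuous_at zero_ereal_def one_ereal_def\<close>)
  then obtain F where F: "\<And>x. 0 < x \<Longrightarrow> x < 1 \<Longrightarrow> (F has_vector_derivative f x) (at x)"
    by (auto simp: zero_ereal_def one_ereal_def)
  have *: "T x = F y - F x + T y" if "0 < x" "x \<le> y" "y < 1" for x y
  proof -
    have c: "continuous_on {x..y} f"
      by (rule continuous_on_subset[OF cont]) (use that in auto)
    have d: "(F has_vector_derivative f z) (at z within {x..y})" if "x \<le> z" "z \<le> y" for z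
      by (rule has_vector_derivative_at_within[OF F]) (use that \<open>0 < x\<close> \<open>y < 1\<close> in auto)
    have "(LBINT s=x..y. f s) = F y - F x"
      by (rule interval_integral_FTC_finite) (use that c d in \<open>auto simp: min_def max_def\<close>)
    moreover have "(LBINT s=x..y. f s) + (LBINT s=y..1. f s) = (LBINT s=x..1. f s)"
      by (rule interval_integral_sum)
        (use that int[of x] in \<open>auto simp: min_def max_def interval_lebesgue_integrable_def one_ereal_def\<close>)
    ultimately show ?thesis by (simp add: T_def)
  qed
  \<comment> \<open>Additivity, applied on whichever side of 1/2 the point lies, shows that T + F is
    constant.\<close>
  define K where "K = T (1/2) + F (1/2)"
  have "T x = K - F x" if "0 < x" "x < 1" for x
    using *[of x "1/2"] *[of "1/2" x] that unfolding K_def by (cases "x \<le> 1/2") simp_all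
  then show ?thesis
    by (intro exI[of _ F] exI[of _ K])
      (auto simp: F has_real_derivative_iff_has_vector_derivative)
qed

lemma DERIV_T: "0 < x \<Longrightarrow> x < 1 \<Longrightarrow> (T has_real_derivative - f x) (at x)"
proof -
  assume x: "0 < x" "x < 1"
  obtain F K where *: "\<forall>x\<in>{0<..<1}. T x = K - F x \<and> (F has_real_derivative f x) (at x)"
    using T_eq_antideriv by (elim exE)
  have "((\<lambda>x. K - F x) has_real_derivative - f x) (at x)"
    using * x by (auto intro!: derivative_eq_intros)
  then show ?thesis
    by (rule has_field_derivative_transform_within_open[where S="{0<..<1}"]) (use x * in auto)
qed

lemma T_less:
  assumes "0 < x" "x < y" "y < 1"
  shows "T y < T x"
proof (rule DERIV_neg_imp_decreasing[where f=T])
  fix z assume "x \<le> z" "z \<le> y"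
  then show "\<exists>d. (T has_real_derivative d) (at z) \<and> d < 0"
    using assms by (intro exI[of _ "- f z"]) (auto intro: DERIV_T pos)
qed (fact assms)

lemma T_less_iff: "x \<in> {0<..<1} \<Longrightarrow> y \<in> {0<..<1} \<Longrightarrow> T y < T x \<longleftrightarrow> x < y"
  using T_less[of x y] T_less[of y x] by (cases x y rule: linorder_cases) auto

lemma inj_T: "inj_on T {0<..<1}"
proof (rule inj_onI)
  fix x y assume "x \<in> {0<..<1}" "y \<in> {0<..<1}" "T x = T y"
  then show "x = y" using T_less_iff[of x y] T_less_iff[of y x] by auto
qed

lemma continuous_T: "continuous_on {0<..<1} T"
  by (intro continuous_at_imp_continuous_on ballI) (auto intro!: DERIV_isCont DERIV_T)

lemma T_pos: "0 < x \<Longrightarrow> x < 1 \<Longrightarrow> 0 < T x"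
proof -
  assume x: "0 < x" "x < 1"
  have "0 \<le> T y" if "0 < y" "y < 1" for y
    unfolding T_eq_set_integral[OF that(2)] set_lebesgue_integral_def
    using that pos by (intro integral_nonneg_AE) (auto simp: indicator_def less_imp_le)
  from this[of "(x+1)/2"] T_less[of x "(x+1)/2"] x show ?thesis by auto
qed

text \<open>The intervals of integration shrink to the empty set. Starting them at 1/2 gives one
  integrable majorant; the density need not be integrable near 0.\<close>

lemma T_small: "0 < e \<Longrightarrow> \<exists>x. 0 < x \<and> x < 1 \<and> T x < e"
proof -
  assume e: "0 < e"
  let ?x = "\<lambda>k::nat. 1 - 1 / (real k + 2)"
  have "(\<lambda>k. LBINT s:{?x k<..<1}. f s) \<longlonglongrightarrow> (LBINT s:{}. f s)"
    unfolding set_lebesgue_integral_def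
  proof (rule integral_dominated_convergence[where w="\<lambda>s. indicator {1/2<..<1} s * \<bar>f s\<bar>"])
    have i: "set_integrable lborel {1/2<..<1} f" by (rule int) auto
    show "integrable lborel (\<lambda>s. indicator {1/2<..<1} s * \<bar>f s\<bar>)"
      using set_integrable_abs[OF i] by (simp add: set_integrable_def)
    show "(\<lambda>s. indicat_real {?x k<..<1} s *\<^sub>R f s) \<in> borel_measurable lborel" for k
      using int[of "?x k"] by (simp add: set_integrable_def borel_measurable_integrable)
    show "AE s in lborel. norm (indicat_real {?x k<..<1} s *\<^sub>R f s) \<le> indicator {1/2<..<1} s * \<bar>f s\<bar>" for k
    proof (intro AE_I2)
      fix s :: real
      have "1 / (real k + 2) \<le> 1 / 2" by (intro divide_left_mono) auto
      then have "1 / 2 < s" if "?x k < s" using that by linarith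
      then show "norm (indicat_real {?x k<..<1} s *\<^sub>R f s) \<le> indicator {1/2<..<1} s * \<bar>f s\<bar>"
        by (auto simp: indicator_def)
    qed
    show "AE s in lborel. (\<lambda>k. indicat_real {?x k<..<1} s *\<^sub>R f s) \<longlonglongrightarrow> indicat_real {} s *\<^sub>R f s"
    proof (intro AE_I2)
      fix s :: real
      have "\<forall>\<^sub>F k in sequentially. indicat_real {?x k<..<1} s *\<^sub>R f s = 0"
      proof (cases "s < 1")
        case True
        have "?x \<longlonglongrightarrow> 1 - 0"
          using LIMSEQ_ignore_initial_segment[OF lim_1_over_n, of 2]
          by (intro tendsto_intros) (simp add: add.commute)
        then have "?x \<longlonglongrightarrow> 1" by simp
        then have "\<forall>\<^sub>F k in sequentially. s < ?x k" using True by (rule order_tendstoD)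
        then show ?thesis by eventually_elim auto
      qed auto
      then show "(\<lambda>k. indicat_real {?x k<..<1} s *\<^sub>R f s) \<longlonglongrightarrow> indicat_real {} s *\<^sub>R f s"
        by (auto intro: tendsto_eventually)
    qed
  qed auto
  then have "(\<lambda>k. T (?x k)) \<longlonglongrightarrow> 0" by (simp add: T_eq_set_integral set_lebesgue_integral_def)
  then have "\<forall>\<^sub>F k in sequentially. T (?x k) < e" using e by (rule order_tendstoD)
  then obtain k where "T (?x k) < e" by (meson eventually_happens sequentially_bot)
  then show ?thesis by (intro exI[of _ "?x k"]) (auto simp: field_simps)
qed

text \<open>By \<open>T_small\<close> the tail gets below every positive value, so an intermediate
  value argument reduces the image of T to the question of how large T becomes near 0.\<close>

lemma T_surj:
  assumes r: "0 < r" and x: "0 < x" "x < 1" "r < T x"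
  shows "r \<in> T ` {0<..<1}"
proof -
  obtain y where y: "0 < y" "y < 1" "T y < r" using T_small[OF r] by auto
  have "x < y" using T_less_iff[of x y] x y by auto
  then have "\<exists>z\<ge>x. z \<le> y \<and> T z = r"
    by (intro IVT2' continuous_on_subset[OF continuous_T]) (use x y in auto)
  then show ?thesis using x y by auto
qed

abbreviation "Tinv \<equiv> the_inv_into {0<..<1} T"

lemma Tinv:
  assumes "r \<in> T ` {0<..<1}"
  shows "T (Tinv r) = r" "0 < Tinv r" "Tinv r < 1"
  using f_the_inv_into_f[OF inj_T assms] the_inv_into_into[OF inj_T assms, of "{0<..<1}"] by auto

text \<open>This order duality turns a bound on the inverse at r into a bound on the tail at a fixed
  point y. Limits of inverses are obtained through it.\<close>

lemma Tinv_less_iff: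
  assumes "r \<in> T ` {0<..<1}" "0 < y" "y < 1"
  shows "Tinv r < y \<longleftrightarrow> T y < r" "y < Tinv r \<longleftrightarrow> r < T y"
  using T_less_iff[of "Tinv r" y] T_less_iff[of y "Tinv r"] Tinv[OF assms(1)] assms by auto

end

section \<open>Beta tails\<close>

context tail_density
begin

text \<open>The two range lemmas separate infinite mass at 0, which is the case of
  \<open>mu_lim\<close>, from finite mass, the case of \<open>mu_n\<close> and of the integrand of
  the Levy exponent.\<close>

lemma range_T_unbounded:
  assumes "\<And>r. \<exists>x\<in>{0<..<1}. r < T x"
  shows "T ` {0<..<1} = {0<..}"
proof (intro equalityI subsetI)
  fix r :: real assume "r \<in> {0<..}"
  then show "r \<in> T ` {0<..<1}" using assms[of r] T_surj by auto
qed (auto intro: T_pos)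

lemma range_T_finite:
  assumes "set_integrable lborel {0<..<1} f"
  shows "T ` {0<..<1} = {0<..<(LBINT s:{0<..<1}. f s)}"
proof -
  let ?L = "LBINT s:{0<..<1}. f s"
  let ?x = "\<lambda>k::nat. 1 / (real k + 2)"
  have le: "T x \<le> ?L" if "0 < x" "x < 1" for x
  proof -
    have "(LBINT s. indicat_real {x<..<1} s *\<^sub>R f s) \<le> (LBINT s. indicat_real {0<..<1} s *\<^sub>R f s)"
      by (rule integral_mono)
        (use that assms int[of x] pos in \<open>auto simp: set_integrable_def indicator_def less_imp_le\<close>)
    then show ?thesis using that by (simp add: T_eq_set_integral set_lebesgue_integral_def)
  qed
  have lim: "(\<lambda>k. LBINT s:{?x k<..<1}. f s) \<longlonglongrightarrow> ?L"
    unfolding set_lebesgue_integral_def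
  proof (rule integral_dominated_convergence[where w="\<lambda>s. indicator {0<..<1} s * \<bar>f s\<bar>"])
    show "integrable lborel (\<lambda>s. indicator {0<..<1} s * \<bar>f s\<bar>)"
      using set_integrable_abs[OF assms] by (simp add: set_integrable_def)
    show "(\<lambda>s. indicat_real {?x k<..<1} s *\<^sub>R f s) \<in> borel_measurable lborel" for k
      using int[of "?x k"] by (simp add: set_integrable_def borel_measurable_integrable)
    show "(\<lambda>s. indicat_real {0<..<1} s *\<^sub>R f s) \<in> borel_measurable lborel"
      using assms by (simp add: set_integrable_def borel_measurable_integrable)
    show "AE s in lborel. norm (indicat_real {?x k<..<1} s *\<^sub>R f s) \<le> indicator {0<..<1} s * \<bar>f s\<bar>" for k
    proof (intro AE_I2)
      fix s :: real
      have "0 < 1 / (real k + 2)" by simp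
      then have "0 < s" if "?x k < s" using that by linarith
      then show "norm (indicat_real {?x k<..<1} s *\<^sub>R f s) \<le> indicator {0<..<1} s * \<bar>f s\<bar>"
        by (auto simp: indicator_def)
    qed
    show "AE s in lborel. (\<lambda>k. indicat_real {?x k<..<1} s *\<^sub>R f s) \<longlonglongrightarrow> indicat_real {0<..<1} s *\<^sub>R f s"
    proof (intro AE_I2)
      fix s :: real
      have "\<forall>\<^sub>F k in sequentially. indicat_real {?x k<..<1} s *\<^sub>R f s = indicat_real {0<..<1} s *\<^sub>R f s"
      proof (cases "0 < s")
        case True
        have "?x \<longlonglongrightarrow> 0"
          using LIMSEQ_ignore_initial_segment[OF lim_1_over_n, of 2] by (simp add: add.commute)
        then have "\<forall>\<^sub>F k in sequentially. ?x k < s" using True by (rule order_tendstoD)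
        then show ?thesis by eventually_elim (use True in \<open>auto simp: indicator_def\<close>)
      next
        case False
        have "\<not> ?x k < s" for k using False divide_pos_pos[of 1 "real k + 2"] by linarith
        then show ?thesis using False by (auto simp: indicator_def)
      qed
      then show "(\<lambda>k. indicat_real {?x k<..<1} s *\<^sub>R f s) \<longlonglongrightarrow> indicat_real {0<..<1} s *\<^sub>R f s"
        by (rule tendsto_eventually)
    qed
  qed
  show ?thesis
  proof (intro equalityI subsetI)
    fix r assume "r \<in> T ` {0<..<1}"
    then obtain x where x: "0 < x" "x < 1" "r = T x" by auto
    \<comment> \<open>Passing to x/2 makes the bound strict: the total mass is a supremum that is
      not attained.\<close>
    then have "r < T (x/2)" using T_less[of "x/2" x] by auto
    then show "r \<in> {0<..<?L}" using le[of "x/2"] T_pos x by auto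
  next
    fix r assume r: "r \<in> {0<..<?L}"
    then have "\<forall>\<^sub>F k in sequentially. r < (LBINT s:{?x k<..<1}. f s)"
      using order_tendstoD(1)[OF lim] by auto
    then obtain k where "r < (LBINT s:{?x k<..<1}. f s)" by (meson eventually_happens sequentially_bot)
    then have "r < T (?x k)" by (subst T_eq_set_integral) auto
    then show "r \<in> T ` {0<..<1}" by (intro T_surj[of _ "?x k"]) (use r in auto)
  qed
qed

end

text \<open>A majorant of all beta densities occurring in \<^const>\<open>mu_n\<close> with an elementary antiderivative.\<close>

definition beta_dom :: "real \<Rightarrow> real \<Rightarrow> real" where
  "beta_dom b s = 2 / s + 2 * (1 - s) powr (b - 1)"

text \<open>Bases in (0, 1) have powers that grow as the exponent falls, so a may be replaced by 0
  and d by b. Splitting at 1/2 then bounds one of the two factors by 2: the power of 1 - s on the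
  left half, 1 / s on the right half.\<close>

lemma beta_dom_bound:
  assumes "0 < s" "s < 1" "0 \<le> a" "0 < b" "b \<le> d"
  shows "s powr (a - 1) * (1 - s) powr (d - 1) \<le> beta_dom b s"
proof -
  have 1: "s powr (a - 1) \<le> s powr (-1)" by (rule powr_mono') (use assms in auto)
  have 2: "(1 - s) powr (d - 1) \<le> (1 - s) powr (b - 1)" by (rule powr_mono') (use assms in auto)
  have m: "s powr (-1) = 1 / s" using assms by (simp add: powr_minus_divide)
  have "s powr (a - 1) * (1 - s) powr (d - 1) \<le> 1 / s * (1 - s) powr (b - 1)"
    unfolding m[symmetric] by (rule mult_mono) (use 1 2 in auto)
  also have "\<dots> \<le> beta_dom b s"
  proof (cases "s \<le> 1/2")
    case True
    have "(1 - s) powr (b - 1) \<le> (1 - s) powr (-1)" by (rule powr_mono') (use assms in auto)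
    also have "\<dots> \<le> 2" using assms True by (simp add: powr_minus_divide field_simps)
    finally have "1 / s * (1 - s) powr (b - 1) \<le> 1 / s * 2"
      using assms by (intro mult_left_mono) auto
    moreover have "0 \<le> 2 * (1 - s) powr (b - 1)" by simp
    ultimately show ?thesis unfolding beta_dom_def by linarith
  next
    case False
    then have "1 / s * (1 - s) powr (b - 1) \<le> 2 * (1 - s) powr (b - 1)"
      using assms by (intro mult_right_mono) (auto simp: field_simps)
    then show ?thesis unfolding beta_dom_def using assms by (smt (verit) divide_nonneg_pos)
  qed
  finally show ?thesis .
qed

lemma beta_dom_integral:
  assumes x: "0 < x" "x < 1" and b: "0 < b"
  shows "set_integrable lborel {x<..<1} (beta_dom b)"
    and "(LBINT s:{x<..<1}. beta_dom b s) \<le> 2 / b - 2 * ln x"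
proof -
  let ?F = "\<lambda>s. 2 * ln s - 2 / b * (1 - s) powr b"
  have D: "(?F has_real_derivative beta_dom b s) (at s)" if "x < s" "s < 1" for s
    using that x b unfolding beta_dom_def
    by (auto intro!: derivative_eq_intros simp: field_simps powr_diff)
  \<comment> \<open>For b < 1 the integrand is singular at 1, so the fundamental theorem is used on
    the open interval, with one-sided limits of F. The limit at 1 is 0, and the integral is - F
    x.\<close>
  have A: "((?F \<circ> real_of_ereal) \<longlongrightarrow> ?F x) (at_right (ereal x))"
    using x b by (auto simp: ereal_tendsto_simps intro!: tendsto_intros)
  have "isCont (\<lambda>s. 2 * ln s) (1::real)" by (intro continuous_intros) auto
  then have "((\<lambda>s. 2 * ln s) \<longlongrightarrow> 0) (at_left (1::real))"
    by (auto simp: continuous_at filterlim_at_split)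
  moreover have "((\<lambda>s. (1 - s) powr b) \<longlongrightarrow> 0 powr b) (at_left (1::real))"
    by (rule tendsto_powr2)
      (use b in \<open>auto intro!: tendsto_eq_intros eventually_at_leftI[of 0]\<close>)
  ultimately have "(?F \<longlongrightarrow> 0 - 2 / b * 0) (at_left (1::real))"
    using b by (intro tendsto_intros) auto
  then have B: "((?F \<circ> real_of_ereal) \<longlongrightarrow> 0) (at_left (ereal 1))"
    unfolding ereal_tendsto_simps by simp
  have C: "isCont (beta_dom b) s" if "ereal x < s" "s < ereal 1" for s
    using that x b unfolding beta_dom_def by (auto intro!: continuous_intros)
  have N: "0 \<le> beta_dom b s" if "0 < s" for s using that unfolding beta_dom_def by simp
  note FTC = interval_integral_FTC_nonneg[of "ereal x" "ereal 1" ?F "beta_dom b", OF _ _ C _ A B]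
  show "set_integrable lborel {x<..<1} (beta_dom b)"
    using FTC(1) x D N by (auto simp: einterval_eq_Icc)
  have "(LBINT s=x..ereal 1. beta_dom b s) = 0 - ?F x"
    by (rule FTC(2)) (use x D N in auto)
  then have "(LBINT s:{x<..<1}. beta_dom b s) = - ?F x"
    using x by (simp add: interval_integral_Ioo)
  moreover have "(1 - x) powr b \<le> 1" using powr_mono2[of b "1 - x" 1] x b by simp
  ultimately show "(LBINT s:{x<..<1}. beta_dom b s) \<le> 2 / b - 2 * ln x"
    using b by (simp add: field_simps)
qed

lemma set_integrable_beta_tail:
  fixes x a d :: real
  assumes x: "0 < x" "x < 1" and "0 \<le> a" "0 < d"
  shows "set_integrable lborel {x<..<1} (\<lambda>s. s powr (a - 1) * (1 - s) powr (d - 1))"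
  by (rule set_integrable_bound[OF beta_dom_integral(1)[of x d]])
    (use assms beta_dom_bound[OF _ _ \<open>0 \<le> a\<close> \<open>0 < d\<close>, of _ d]
     in \<open>auto simp: set_borel_measurable_def beta_dom_def\<close>)

section \<open>Beta densities, their tails and the ranges of the tails\<close>

lemma tail_density_beta:
  assumes "0 < C" "0 \<le> a" "0 < d"
  shows "tail_density (\<lambda>s. C * (s powr (a - 1) * (1 - s) powr (d - 1)))"
proof
  show "continuous_on {0<..<1} (\<lambda>s. C * (s powr (a - 1) * (1 - s) powr (d - 1)))"
    by (intro continuous_intros) auto
  show "set_integrable lborel {x<..<1} (\<lambda>s. C * (s powr (a - 1) * (1 - s) powr (d - 1)))"
    if "0 < x" "x < 1" for x
    using set_integrable_beta_tail[OF that assms(2,3)] by (rule set_integrable_mult_right)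
qed (use assms in auto)

text \<open>The limiting tail is the degenerate beta case a = 0; the exponent is written
  \<open>0 - 1\<close> to match \<open>tail_density_beta\<close>.\<close>

lemma mu_lim_eq_T:
  assumes "0 < c" "0 < \<gamma>"
  shows "mu_lim c \<gamma> = tail_density.T (\<lambda>s. c * \<gamma> * (s powr (0 - 1) * (1 - s) powr (c - 1)))"
proof -
  interpret tail_density "\<lambda>s. c * \<gamma> * (s powr (0 - 1) * (1 - s) powr (c - 1))"
    by (rule tail_density_beta) (use assms in auto)
  show ?thesis
    by (rule ext) (simp only: T_def mu_lim_def interval_lebesgue_integral_mult_right, simp)
qed

lemma mu_n_eq_T:
  fixes n :: nat and c \<gamma> :: real
  assumes c: "0 < c" and g: "0 < \<gamma>" "\<gamma> < n"
  defines "C \<equiv> Gamma c / (Gamma (c * \<gamma> / n) * Gamma (c - c * \<gamma> / n))"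
  shows "0 < C" "mu_n c \<gamma> n = tail_density.T (\<lambda>s. C * (s powr (c * \<gamma> / n - 1) * (1 - s) powr (c - c * \<gamma> / n - 1)))"
proof -
  have p: "0 < c * \<gamma> / n" "0 < c - c * \<gamma> / n"
    using c g by (auto simp: field_simps)
  show "0 < C"
    unfolding C_def using Gamma_real_pos[OF p(1)] Gamma_real_pos[OF p(2)] Gamma_real_pos[OF c] by simp
  then interpret tail_density "\<lambda>s. C * (s powr (c * \<gamma> / n - 1) * (1 - s) powr (c - c * \<gamma> / n - 1))"
    by (rule tail_density_beta) (use p in linarith)+
  show "mu_n c \<gamma> n = T"
    by (rule ext) (simp only: T_def interval_lebesgue_integral_mult_right,
      simp add: mu_n_def C_def right_diff_distrib)
qed

text \<open>\<open>has_integral_Beta_real\<close> speaks of the gauge integral. Nonnegativity makes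
  it absolute, and Borel measurability brings it from the completed measure down to
  \<open>lborel\<close>.\<close>

lemma Beta_integral_lborel:
  fixes a b :: real
  assumes a: "0 < a" and b: "0 < b"
  shows "set_integrable lborel {0<..<1} (\<lambda>t. t powr (a - 1) * (1 - t) powr (b - 1))"
    and "(LBINT t:{0<..<1}. t powr (a - 1) * (1 - t) powr (b - 1)) = Beta a b"
proof -
  let ?g = "\<lambda>t. t powr (a - 1) * (1 - t) powr (b - 1)"
  have B: "(?g has_integral Beta a b) {0<..<1}"
    using has_integral_Beta_real[OF a b] by (simp add: has_integral_Icc_iff_Ioo)
  then have "?g absolutely_integrable_on {0<..<1}"
    by (intro nonnegative_absolutely_integrable_1) auto
  moreover have "(\<lambda>x. indicat_real {0<..<1} x *\<^sub>R ?g x) \<in> borel_measurable lborel"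
    by measurable
  ultimately show i: "set_integrable lborel {0<..<1} ?g"
    unfolding set_integrable_def by (simp add: integrable_completion)
  show "(LBINT t:{0<..<1}. ?g t) = Beta a b"
    using set_borel_integral_eq_integral(2)[OF i] B by (simp add: integral_unique)
qed

text \<open>\<open>mu_n\<close> is the survival function of the beta distribution with parameters c
  * \<gamma> / n and c - c * \<gamma> / n, so its total mass is 1.\<close>

lemma mu_n_image:
  fixes n :: nat and c \<gamma> :: real
  assumes c: "0 < c" and g: "0 < \<gamma>" "\<gamma> < n"
  shows "mu_n c \<gamma> n ` {0<..<1} = {0<..<1}"
proof -
  define C where "C = Gamma c / (Gamma (c * \<gamma> / n) * Gamma (c - c * \<gamma> / n))"
  have p: "0 < c * \<gamma> / n" "0 < c - c * \<gamma> / n"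
    using c g by (auto simp: field_simps)
  note mu = mu_n_eq_T[OF c g, folded C_def]
  interpret tail_density "\<lambda>s. C * (s powr (c * \<gamma> / n - 1) * (1 - s) powr (c - c * \<gamma> / n - 1))"
    by (rule tail_density_beta) (use p mu(1) in linarith)+
  have "Beta (c * \<gamma> / n) (c - c * \<gamma> / n) = 1 / C"
    unfolding C_def Beta_def by simp
  then have "C * Beta (c * \<gamma> / n) (c - c * \<gamma> / n) = 1" using mu(1) by simp
  then show ?thesis
    using range_T_finite[OF set_integrable_mult_right[OF Beta_integral_lborel(1)[OF p]]]
    by (simp add: mu(2) Beta_integral_lborel(2)[OF p])
qed

lemma mu_lim_image:
  assumes c: "0 < c" and g: "0 < \<gamma>"
  shows "mu_lim c \<gamma> ` {0<..<1} = {0<..}"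
proof -
  define f where "f = (\<lambda>s. c * \<gamma> * (s powr (0 - 1) * (1 - s) powr (c - 1)))"
  interpret tail_density f
    unfolding f_def by (rule tail_density_beta) (use assms in auto)
  \<comment> \<open>K / s is a lower bound of the density on (0, 1/2]. Depending on the sign of c -
    1, the power of 1 - s has its infimum at one end or the other of that interval, hence the
    minimum.\<close>
  define K where "K = c * \<gamma> * min 1 ((1/2) powr (c - 1))"
  have K: "0 < K" unfolding K_def using assms by auto
  have lower: "K * (ln (1/2) - ln x) \<le> T x" if x: "0 < x" "x < 1/2" for x
  proof -
    have D: "((\<lambda>s. T s + K * ln s) has_real_derivative
        K / s - f s) (at s)" if "0 < s" "s < 1" for s
      using that by (auto intro!: derivative_eq_intros DERIV_T)
    have N: "K / s - f s \<le> 0" if s: "0 < s" "s \<le> 1/2" for s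
    proof -
      have "min 1 ((1/2) powr (c - 1)) \<le> (1 - s) powr (c - 1)"
      proof (cases "1 \<le> c")
        case True
        then have "(1/2) powr (c - 1) \<le> (1 - s) powr (c - 1)" using s by (intro powr_mono2) auto
        then show ?thesis by simp
      next
        case False
        then have "(1 - s) powr 0 \<le> (1 - s) powr (c - 1)" using s by (intro powr_mono') auto
        then show ?thesis using s by simp
      qed
      then have "c * \<gamma> * min 1 ((1/2) powr (c - 1)) \<le> c * \<gamma> * (1 - s) powr (c - 1)"
        using assms by (intro mult_left_mono) auto
      then have "K / s \<le> (c * \<gamma> * (1 - s) powr (c - 1)) / s"
        unfolding K_def using s by (intro divide_right_mono) auto
      then show ?thesis unfolding f_def using s by (simp add: powr_minus_divide)
    qed
    have "T (1/2) + K * ln (1/2) \<le> T x + K * ln x"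
    proof (rule DERIV_nonpos_imp_nonincreasing[where f = "\<lambda>s. T s + K * ln s"])
      fix s assume "x \<le> s" "s \<le> 1/2"
      then show "\<exists>d. ((\<lambda>s. T s + K * ln s) has_real_derivative d) (at s) \<and> d \<le> 0"
        using D[of s] N[of s] x by auto
    qed (use x in auto)
    then show ?thesis using T_pos[of "1/2"] by (simp add: algebra_simps)
  qed
  have "\<exists>x\<in>{0<..<1}. r < T x" for r
  proof -
    \<comment> \<open>Chosen so that K * (ln (1/2) - ln x) is at least r + K; the bound 1/4 keeps x
      inside the range of \<open>lower\<close>.\<close>
    define x where "x = min (1/4) (exp (ln (1/2) - r / K - 1))"
    have x: "0 < x" "x < 1/2" unfolding x_def by auto
    have "ln x \<le> ln (exp (ln (1/2) - r / K - 1))"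
      using x by (subst ln_le_cancel_iff) (auto simp: x_def)
    then have "r / K + 1 \<le> ln (1/2) - ln x" by simp
    then have "K * (r / K + 1) \<le> K * (ln (1/2) - ln x)" using K by (intro mult_left_mono) auto
    then have "r < T x" using lower[OF x] K by (simp add: algebra_simps)
    then show ?thesis using x by force
  qed
  then show ?thesis using range_T_unbounded by (simp add: mu_lim_eq_T[OF assms] f_def)
qed

section \<open>Asymptotics and domination of the scaled tails\<close>

definition mu_coeff :: "real \<Rightarrow> real \<Rightarrow> nat \<Rightarrow> real" where
  "mu_coeff c \<gamma> n = real n * Gamma c / (Gamma (c * \<gamma> / n) * Gamma (c - c * \<gamma> / n))"

text \<open>With a = c * \<gamma> / n, the functional equation a * Gamma a = Gamma (a + 1) removes
  the pole, and n = c * \<gamma> / a supplies exactly the missing factor 1 / a.\<close>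

lemma mu_coeff_tendsto:
  assumes c: "0 < c" and g: "0 < \<gamma>"
  shows "mu_coeff c \<gamma> \<longlonglongrightarrow> c * \<gamma>"
proof -
  let ?a = "\<lambda>n::nat. c * \<gamma> / n"
  have nz: "Gamma c \<noteq> 0" using Gamma_real_pos[OF c] by linarith
  have a: "?a \<longlonglongrightarrow> 0" by (rule lim_const_over_n)
  have "(\<lambda>n. c * \<gamma> * Gamma c / (Gamma (?a n + 1) * Gamma (c - ?a n))) \<longlonglongrightarrow>
      c * \<gamma> * Gamma c / (Gamma (0 + 1) * Gamma (c - 0))"
    using c nz by (intro tendsto_intros a) (auto simp: nonpos_Ints_def)
  then have "(\<lambda>n. c * \<gamma> * Gamma c / (Gamma (?a n + 1) * Gamma (c - ?a n))) \<longlonglongrightarrow> c * \<gamma>"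
    using Gamma_real_pos[OF c] by simp
  moreover have "\<forall>\<^sub>F n in sequentially. c * \<gamma> * Gamma c / (Gamma (?a n + 1) * Gamma (c - ?a n)) = mu_coeff c \<gamma> n"
    using eventually_gt_at_top[of 0]
  proof eventually_elim
    case (elim n)
    then have "0 < ?a n" using c g by simp
    then have "Gamma (?a n + 1) = ?a n * Gamma (?a n)"
      by (intro Gamma_plus1) (auto simp: nonpos_Ints_def)
    then have "c * \<gamma> * Gamma c / (Gamma (?a n + 1) * Gamma (c - ?a n)) =
        (c * \<gamma> / ?a n) * Gamma c / (Gamma (?a n) * Gamma (c - ?a n))"
      by (simp only: times_divide_eq_left divide_divide_eq_left mult.assoc)
    also have "c * \<gamma> / ?a n = n" using elim c g by simp
    finally show ?case by (simp add: mu_coeff_def)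
  qed
  ultimately show ?thesis by (rule Lim_transform_eventually)
qed

lemma scaled_mu_n_eq:
  fixes n :: nat and c \<gamma> :: real
  assumes "0 < c" "0 < \<gamma>" "\<gamma> < n" "y < 1"
  shows "real n * mu_n c \<gamma> n y =
    mu_coeff c \<gamma> n * (LBINT s:{y<..<1}. s powr (c * \<gamma> / n - 1) * (1 - s) powr (c - c * \<gamma> / n - 1))"
proof -
  have e: "c * (1 - \<gamma> / n) = c - c * \<gamma> / n" by (simp add: algebra_simps)
  have "mu_n c \<gamma> n y = Gamma c / (Gamma (c * \<gamma> / real n) * Gamma (c - c * \<gamma> / real n)) *
     (LBINT s:{y<..<1}. s powr (c * \<gamma> / n - 1) * (1 - s) powr (c - c * \<gamma> / n - 1))"
    unfolding mu_n_def e using assms(4) by (subst interval_integral_Ioo) (auto simp: one_ereal_def)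
  then show ?thesis by (simp add: mu_coeff_def)
qed

text \<open>The bound c / 2 keeps the second beta parameter at least c / 2, so that
  \<open>beta_dom (c / 2)\<close> is one majorant for all large n.\<close>

lemma eventually_small_shape:
  fixes c \<gamma> :: real
  assumes "0 < c" "0 < \<gamma>"
  shows "\<forall>\<^sub>F n :: nat in sequentially. \<gamma> < n \<and> 0 \<le> c * \<gamma> / n \<and> c * \<gamma> / n \<le> c / 2"
  using eventually_gt_at_top[of "nat \<lceil>2 * \<gamma>\<rceil>"]
proof eventually_elim
  case (elim n)
  then have "2 * \<gamma> < n" by linarith
  then have "c * (2 * \<gamma>) \<le> c * n" using assms by (intro mult_left_mono) auto
  then show ?case using \<open>2 * \<gamma> < n\<close> assms by (auto simp: field_simps)
qed

lemma scaled_mu_n_tendsto: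
  fixes c \<gamma> y :: real
  assumes c: "0 < c" and g: "0 < \<gamma>" and y: "0 < y" "y < 1"
  shows "(\<lambda>n. real n * mu_n c \<gamma> n y) \<longlonglongrightarrow> mu_lim c \<gamma> y"
proof -
  let ?g = "\<lambda>n s. s powr (c * \<gamma> / real n - 1) * (1 - s) powr (c - c * \<gamma> / real n - 1)"
  obtain N :: nat where N: "\<And>n. n \<ge> N \<Longrightarrow> \<gamma> < n \<and> 0 \<le> c * \<gamma> / n \<and> c * \<gamma> / n \<le> c / 2"
    using eventually_small_shape[OF c g] unfolding eventually_sequentially by blast
  \<comment> \<open>The shift by N is undone at the end: dominated convergence asks for the majorant
    at every index, and it is available only from N on.\<close>
  have "(\<lambda>n. LBINT s:{y<..<1}. ?g (n + N) s) \<longlonglongrightarrow> (LBINT s:{y<..<1}. s powr (0 - 1) * (1 - s) powr (c - 0 - 1))"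
    unfolding set_lebesgue_integral_def
  proof (rule integral_dominated_convergence[where w="\<lambda>s. indicat_real {y<..<1} s *\<^sub>R beta_dom (c / 2) s"])
    show "integrable lborel (\<lambda>s. indicat_real {y<..<1} s *\<^sub>R beta_dom (c / 2) s)"
      using beta_dom_integral(1)[OF y, of "c/2"] c by (simp add: set_integrable_def)
    show "AE s in lborel. norm (indicat_real {y<..<1} s *\<^sub>R ?g (n + N) s) \<le> indicat_real {y<..<1} s *\<^sub>R beta_dom (c / 2) s" for n
      using beta_dom_bound[of _ "c * \<gamma> / real (n + N)" "c / 2" "c - c * \<gamma> / real (n + N)"] N[of "n + N"] c y
      by (intro AE_I2) (auto simp: indicator_def)
    have "(\<lambda>n. c * \<gamma> / real (n + N)) \<longlonglongrightarrow> 0"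
      by (rule LIMSEQ_ignore_initial_segment[OF lim_const_over_n])
    then show "AE s in lborel. (\<lambda>n. indicat_real {y<..<1} s *\<^sub>R ?g (n + N) s) \<longlonglongrightarrow>
        indicat_real {y<..<1} s *\<^sub>R (s powr (0 - 1) * (1 - s) powr (c - 0 - 1))"
    proof (intro AE_I2)
      fix s :: real assume a: "(\<lambda>n. c * \<gamma> / real (n + N)) \<longlonglongrightarrow> 0"
      have "(\<lambda>n. ?g (n + N) s) \<longlonglongrightarrow> s powr (0 - 1) * (1 - s) powr (c - 0 - 1)" if "y < s" "s < 1"
        by (intro tendsto_intros a) (use that y in auto)
      then show "(\<lambda>n. indicat_real {y<..<1} s *\<^sub>R ?g (n + N) s) \<longlonglongrightarrow>
          indicat_real {y<..<1} s *\<^sub>R (s powr (0 - 1) * (1 - s) powr (c - 0 - 1))"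
        by (cases "y < s \<and> s < 1") (auto simp: indicator_def simp del: of_nat_add)
    qed
  qed measurable
  then have "(\<lambda>n. mu_coeff c \<gamma> (n + N) * (LBINT s:{y<..<1}. ?g (n + N) s)) \<longlonglongrightarrow>
      c * \<gamma> * (LBINT s:{y<..<1}. s powr (0 - 1) * (1 - s) powr (c - 0 - 1))"
    by (intro tendsto_intros LIMSEQ_ignore_initial_segment[OF mu_coeff_tendsto] c g)
  moreover have "c * \<gamma> * (LBINT s:{y<..<1}. s powr (0 - 1) * (1 - s) powr (c - 0 - 1)) = mu_lim c \<gamma> y"
    unfolding mu_lim_def using y by (subst interval_integral_Ioo) (auto simp: one_ereal_def)
  moreover have "mu_coeff c \<gamma> (n + N) * (LBINT s:{y<..<1}. ?g (n + N) s) = real (n + N) * mu_n c \<gamma> (n + N) y" for n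
    using scaled_mu_n_eq[OF c g _ y(2), of "n + N"] N[of "n + N"] by simp
  ultimately have "(\<lambda>n. real (n + N) * mu_n c \<gamma> (n + N) y) \<longlonglongrightarrow> mu_lim c \<gamma> y" by simp
  then show ?thesis by (rule LIMSEQ_offset)
qed

text \<open>The threshold for n is independent of y, so the bound can later be used at all atoms of
  one measure at once. The constant 4 / c is 2 / b for b = c / 2, and c * \<gamma> + 1 eventually
  bounds the converging coefficients.\<close>

lemma scaled_mu_n_bound:
  fixes c \<gamma> :: real
  assumes c: "0 < c" and g: "0 < \<gamma>"
  shows "\<forall>\<^sub>F n in sequentially. \<forall>y. 0 < y \<longrightarrow> y < 1 \<longrightarrow>
    real n * mu_n c \<gamma> n y \<le> (c * \<gamma> + 1) * (4 / c - 2 * ln y)"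
proof -
  have "\<forall>\<^sub>F n in sequentially. mu_coeff c \<gamma> n < c * \<gamma> + 1"
    using order_tendstoD(2)[OF mu_coeff_tendsto[OF c g], of "c * \<gamma> + 1"] by simp
  with eventually_small_shape[OF c g] show ?thesis
  proof eventually_elim
    case (elim n)
    show ?case
    proof (intro allI impI)
      fix y :: real assume y: "0 < y" "y < 1"
      let ?g = "\<lambda>s. s powr (c * \<gamma> / real n - 1) * (1 - s) powr (c - c * \<gamma> / real n - 1)"
      have i: "set_integrable lborel {y<..<1} ?g"
        by (rule set_integrable_beta_tail) (use elim c y in linarith)+
      have "(LBINT s:{y<..<1}. ?g s) \<le> (LBINT s:{y<..<1}. beta_dom (c / 2) s)"
        using i beta_dom_integral(1)[OF y, of "c/2"] c
        unfolding set_lebesgue_integral_def set_integrable_def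
      proof (intro integral_mono)
        fix s :: real
        show "indicat_real {y<..<1} s *\<^sub>R ?g s \<le> indicat_real {y<..<1} s *\<^sub>R beta_dom (c / 2) s"
          using beta_dom_bound[of s "c * \<gamma> / real n" "c / 2" "c - c * \<gamma> / real n"] elim c y
          by (auto simp: indicator_def)
      qed auto
      also have "\<dots> \<le> 2 / (c / 2) - 2 * ln y" by (rule beta_dom_integral(2)) (use c y in auto)
      finally have le: "(LBINT s:{y<..<1}. ?g s) \<le> 4 / c - 2 * ln y" by simp
      have "0 \<le> (LBINT s:{y<..<1}. ?g s)"
        unfolding set_lebesgue_integral_def by (intro integral_nonneg_AE) auto
      then have "mu_coeff c \<gamma> n * (LBINT s:{y<..<1}. ?g s) \<le> (c * \<gamma> + 1) * (4 / c - 2 * ln y)"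
        using le elim c g by (intro mult_mono) auto
      then show "real n * mu_n c \<gamma> n y \<le> (c * \<gamma> + 1) * (4 / c - 2 * ln y)"
        using scaled_mu_n_eq[OF c g _ y(2), of n] elim by simp
    qed
  qed
qed

section \<open>Convergence along a fixed arrival sequence\<close>

lemma mu_n_inv:
  fixes n :: nat and c \<gamma> :: real
  assumes c: "0 < c" and g: "0 < \<gamma>" "\<gamma> < n" and r: "0 < r" "r < 1"
  shows "mu_n c \<gamma> n (the_inv_into {0<..<1} (mu_n c \<gamma> n) r) = r"
    and "the_inv_into {0<..<1} (mu_n c \<gamma> n) r \<in> {0<..<1}"
    and "0 < y \<Longrightarrow> y < 1 \<Longrightarrow> the_inv_into {0<..<1} (mu_n c \<gamma> n) r < y \<longleftrightarrow> mu_n c \<gamma> n y < r"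
    and "0 < y \<Longrightarrow> y < 1 \<Longrightarrow> y < the_inv_into {0<..<1} (mu_n c \<gamma> n) r \<longleftrightarrow> r < mu_n c \<gamma> n y"
proof -
  define C where "C = Gamma c / (Gamma (c * \<gamma> / n) * Gamma (c - c * \<gamma> / n))"
  have p: "0 < c * \<gamma> / n" "0 < c - c * \<gamma> / n"
    using c g by (auto simp: field_simps)
  note mu = mu_n_eq_T[OF c g, folded C_def]
  interpret tail_density "\<lambda>s. C * (s powr (c * \<gamma> / n - 1) * (1 - s) powr (c - c * \<gamma> / n - 1))"
    by (rule tail_density_beta) (use p mu(1) in linarith)+
  have r': "r \<in> T ` {0<..<1}" using mu_n_image[OF c g] r unfolding mu(2) by auto
  show "mu_n c \<gamma> n (the_inv_into {0<..<1} (mu_n c \<gamma> n) r) = r"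
    "the_inv_into {0<..<1} (mu_n c \<gamma> n) r \<in> {0<..<1}"
    "0 < y \<Longrightarrow> y < 1 \<Longrightarrow> the_inv_into {0<..<1} (mu_n c \<gamma> n) r < y \<longleftrightarrow> mu_n c \<gamma> n y < r"
    "0 < y \<Longrightarrow> y < 1 \<Longrightarrow> y < the_inv_into {0<..<1} (mu_n c \<gamma> n) r \<longleftrightarrow> r < mu_n c \<gamma> n y"
    unfolding mu(2) using Tinv[OF r'] Tinv_less_iff[OF r'] by (simp_all only: greaterThanLessThan_iff simp_thms)
qed

lemma mu_lim_inv:
  assumes c: "0 < c" and g: "0 < \<gamma>" and r: "0 < r"
  shows "mu_lim c \<gamma> (the_inv_into {0<..<1} (mu_lim c \<gamma>) r) = r"
    and "the_inv_into {0<..<1} (mu_lim c \<gamma>) r \<in> {0<..<1}"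
    and "0 < y \<Longrightarrow> y < 1 \<Longrightarrow> the_inv_into {0<..<1} (mu_lim c \<gamma>) r < y \<longleftrightarrow> mu_lim c \<gamma> y < r"
    and "0 < y \<Longrightarrow> y < 1 \<Longrightarrow> y < the_inv_into {0<..<1} (mu_lim c \<gamma>) r \<longleftrightarrow> r < mu_lim c \<gamma> y"
proof -
  note mu = mu_lim_eq_T[OF c g]
  interpret tail_density "\<lambda>s. c * \<gamma> * (s powr (0 - 1) * (1 - s) powr (c - 1))"
    by (rule tail_density_beta) (use c g in auto)
  have r': "r \<in> T ` {0<..<1}" using mu_lim_image[OF c g] r unfolding mu by auto
  show "mu_lim c \<gamma> (the_inv_into {0<..<1} (mu_lim c \<gamma>) r) = r"
    "the_inv_into {0<..<1} (mu_lim c \<gamma>) r \<in> {0<..<1}"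
    "0 < y \<Longrightarrow> y < 1 \<Longrightarrow> the_inv_into {0<..<1} (mu_lim c \<gamma>) r < y \<longleftrightarrow> mu_lim c \<gamma> y < r"
    "0 < y \<Longrightarrow> y < 1 \<Longrightarrow> y < the_inv_into {0<..<1} (mu_lim c \<gamma>) r \<longleftrightarrow> r < mu_lim c \<gamma> y"
    unfolding mu using Tinv[OF r'] Tinv_less_iff[OF r'] by (simp_all only: greaterThanLessThan_iff simp_thms)
qed

text \<open>Monotonicity makes pointwise convergence of the tails sufficient: for y on one side of
  the limit, the strict inequality between \<open>mu_lim\<close> at y and r0 passes to n times
  \<open>mu_n\<close> at y and n times r n, and the order duality returns it to the
  inverses.\<close>

lemma mu_n_inv_tendsto:
  fixes c \<gamma> :: real and r :: "nat \<Rightarrow> real"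
  assumes c: "0 < c" and g: "0 < \<gamma>" and r: "0 < r0" and lim: "(\<lambda>n. real n * r n) \<longlonglongrightarrow> r0"
    and r1: "\<forall>\<^sub>F n in sequentially. 0 < r n \<and> r n < 1"
  shows "(\<lambda>n. the_inv_into {0<..<1} (mu_n c \<gamma> n) (r n)) \<longlonglongrightarrow> the_inv_into {0<..<1} (mu_lim c \<gamma>) r0"
    (is "?w \<longlonglongrightarrow> ?u")
proof (rule order_tendstoI)
  note w0 = mu_lim_inv[OF c g r]
  have ng: "\<forall>\<^sub>F n :: nat in sequentially. \<gamma> < n" using eventually_small_shape[OF c g] by eventually_elim auto
  {
    fix a assume a: "a < ?u"
    \<comment> \<open>y separates a from the limit and stays inside (0, 1) even when a does
      not.\<close>
    define y where "y = max a (?u / 2)"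
    have y: "0 < y" "y < 1" "y < ?u" "a \<le> y" unfolding y_def using a w0(2) by auto
    then have "r0 < mu_lim c \<gamma> y" using w0(4) by auto
    then have "0 < mu_lim c \<gamma> y - r0" by simp
    from order_tendstoD(1)[OF tendsto_diff[OF scaled_mu_n_tendsto[OF c g y(1,2)] lim] this] ng r1
    show "\<forall>\<^sub>F n in sequentially. a < ?w n"
    proof eventually_elim
      case (elim n)
      then have "real n * r n < real n * mu_n c \<gamma> n y" by simp
      then have "r n < mu_n c \<gamma> n y" using elim g by (simp add: mult_less_cancel_left)
      then show ?case using mu_n_inv(4)[OF c g _ _ _ y(1,2), of n "r n"] elim y by auto
    qed
  }
  {
    fix a assume a: "?u < a"
    define y where "y = min a ((?u + 1) / 2)"
    have y: "0 < y" "y < 1" "?u < y" "y \<le> a" unfolding y_def using a w0(2) by (auto simp: min_less_iff_disj)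
    then have "mu_lim c \<gamma> y < r0" using w0(3) by auto
    then have "mu_lim c \<gamma> y - r0 < 0" by simp
    from order_tendstoD(2)[OF tendsto_diff[OF scaled_mu_n_tendsto[OF c g y(1,2)] lim] this] ng r1
    show "\<forall>\<^sub>F n in sequentially. ?w n < a"
    proof eventually_elim
      case (elim n)
      then have "real n * mu_n c \<gamma> n y < real n * r n" by simp
      then have "mu_n c \<gamma> n y < r n" using elim g by (simp add: mult_less_cancel_left)
      then show ?case using mu_n_inv(3)[OF c g _ _ _ y(1,2), of n "r n"] elim y by auto
    qed
  }
qed

text \<open>Indices start at 0: G i is the arrival time with number i + 1, so G n is the one with
  number n + 1 and i < n runs through n atoms. Extension by 0 gives all n a common index set for
  dominated convergence.\<close>

definition w_n :: "real \<Rightarrow> real \<Rightarrow> (nat \<Rightarrow> real) \<Rightarrow> nat \<Rightarrow> nat \<Rightarrow> real" where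
  "w_n c \<gamma> G n i = (if i < n then the_inv_into {0<..<1} (mu_n c \<gamma> n) (G i / G n) else 0)"

definition w_lim :: "real \<Rightarrow> real \<Rightarrow> (nat \<Rightarrow> real) \<Rightarrow> nat \<Rightarrow> real" where
  "w_lim c \<gamma> G i = the_inv_into {0<..<1} (mu_lim c \<gamma>) (G i)"

text \<open>These are the properties shared by almost all realizations of the arrival times; the
  convergence statement is proved pathwise from them.\<close>

locale arrival_times =
  fixes G :: "nat \<Rightarrow> real" and c \<gamma> :: real
  assumes c: "0 < c" and g: "0 < \<gamma>"
    and G_pos: "\<And>i. 0 < G i" and G_mono: "strict_mono G"
    and G_lim: "(\<lambda>n. G n / real n) \<longlonglongrightarrow> 1"
begin

lemma ratio: "i < n \<Longrightarrow> 0 < G i / G n" "i < n \<Longrightarrow> G i / G n < 1"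
  using G_pos[of i] G_pos[of n] G_mono by (auto simp: strict_mono_def)

lemma w_lim_range: "0 < w_lim c \<gamma> G i" "w_lim c \<gamma> G i < 1"
  using mu_lim_inv(2)[OF c g G_pos[of i]] by (auto simp: w_lim_def)

lemma inverse_rate: "(\<lambda>n. real n / G n) \<longlonglongrightarrow> 1"
  using tendsto_inverse[OF G_lim] by simp

lemma w_n_tendsto: "(\<lambda>n. w_n c \<gamma> G n i) \<longlonglongrightarrow> w_lim c \<gamma> G i"
proof -
  have e: "\<forall>\<^sub>F n in sequentially. i < n" by (rule eventually_gt_at_top)
  have "(\<lambda>n. real n / G n * G i) \<longlonglongrightarrow> 1 * G i" by (intro tendsto_intros inverse_rate)
  then have "(\<lambda>n. real n * (G i / G n)) \<longlonglongrightarrow> G i" by simp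
  then have "(\<lambda>n. the_inv_into {0<..<1} (mu_n c \<gamma> n) (G i / G n)) \<longlonglongrightarrow> w_lim c \<gamma> G i"
    unfolding w_lim_def
    by (intro mu_n_inv_tendsto c g G_pos eventually_mono[OF e]) (simp_all only: ratio simp_thms)
  then show ?thesis
    by (rule Lim_transform_eventually) (rule eventually_mono[OF e], simp add: w_n_def)
qed

text \<open>At the i-th atom, n times \<open>mu_n\<close> equals (n / G n) * G i and hence grows
  linearly in i, while \<open>scaled_mu_n_bound\<close> limits it by an affine function of - ln of
  the atom. Solving for the atom gives exponential decay, uniformly in n.\<close>

lemma w_n_dominated:
  obtains C q where "0 < q" "q < 1"
    "\<forall>\<^sub>F n in sequentially. \<forall>i. 0 \<le> w_n c \<gamma> G n i \<and> w_n c \<gamma> G n i \<le> C * q ^ i"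
proof -
  have "\<forall>\<^sub>F i in sequentially. 1 / 2 < G i / real i" by (rule order_tendstoD(1)[OF G_lim]) simp
  then obtain N where N: "\<And>i. i \<ge> N \<Longrightarrow> 1 / 2 < G i / real i"
    unfolding eventually_sequentially by blast
  \<comment> \<open>Subtracting N makes the left side nonpositive for i up to N, so the bound holds
    for every index.\<close>
  have G_lower: "(real i - real N) / 2 \<le> G i" for i
  proof (cases "N < i")
    case True
    then show ?thesis using N[of i] by (simp add: field_simps)
  next
    case False
    then show ?thesis using G_pos[of i] by (simp add: field_simps)
  qed
  define K where "K = c * \<gamma> + 1"
  have K: "0 < K" unfolding K_def using c g by (simp add: add_pos_pos)
  have r: "\<forall>\<^sub>F n in sequentially. 1 / 2 < real n / G n" by (rule order_tendstoD(1)[OF inverse_rate]) simp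
  have ng: "\<forall>\<^sub>F n :: nat in sequentially. \<gamma> < n" using eventually_small_shape[OF c g] by eventually_elim auto
  have "\<forall>\<^sub>F n in sequentially. \<forall>i. 0 \<le> w_n c \<gamma> G n i \<and>
      w_n c \<gamma> G n i \<le> exp (2 / c + N / (8 * K)) * exp (- 1 / (8 * K)) ^ i"
    using r scaled_mu_n_bound[OF c g] ng
  proof eventually_elim
    case (elim n)
    show ?case
    proof
      fix i
      show "0 \<le> w_n c \<gamma> G n i \<and> w_n c \<gamma> G n i \<le> exp (2 / c + N / (8 * K)) * exp (- 1 / (8 * K)) ^ i"
      proof (cases "i < n")
        case True
        let ?w = "w_n c \<gamma> G n i"
        note w = mu_n_inv(1,2)[OF c g elim(3) ratio[OF True]]
        have w1: "0 < ?w" "?w < 1" "real n * mu_n c \<gamma> n ?w = real n / G n * G i"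
          using w True by (auto simp: w_n_def)
        \<comment> \<open>The quarter is 1/2 from the growth of G times 1/2 from n / G n; dividing
          by K and by the coefficient 2 of ln gives the rate 1 / (8 * K).\<close>
        have "(real i - real N) / 4 \<le> 1 / 2 * G i" using G_lower[of i] by simp
        also have "\<dots> \<le> real n / G n * G i"
          using elim(1) G_pos[of i] by (intro mult_right_mono) auto
        also have "\<dots> \<le> K * (4 / c - 2 * ln ?w)"
          unfolding K_def using elim(2) w1 by metis
        finally have "(real i - real N) / 4 / K \<le> 4 / c - 2 * ln ?w"
          using K by (simp add: pos_divide_le_eq mult_ac)
        then have "ln ?w \<le> 2 / c - (real i - real N) / (8 * K)"
          by simp
        also have "\<dots> = 2 / c + N / (8 * K) + real i * (- 1 / (8 * K))"
          by (simp add: diff_divide_distrib)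
        finally have "exp (ln ?w) \<le> exp (2 / c + N / (8 * K) + real i * (- 1 / (8 * K)))"
          by (simp only: exp_le_cancel_iff)
        then have "?w \<le> exp (2 / c + N / (8 * K)) * exp (- 1 / (8 * K)) ^ i"
          using w1(1) by (simp only: exp_ln exp_add exp_of_nat_mult)
        then show ?thesis using w1 by simp
      qed (auto simp: w_n_def)
    qed
  qed
  then show ?thesis by (rule that[rotated 2]) (use K in auto)
qed

text \<open>The bound is inherited from \<open>w_n\<close> as n grows, since C and q do not depend
  on n.\<close>

lemma w_lim_dominated:
  obtains C q where "0 < q" "q < 1" "\<forall>i. w_lim c \<gamma> G i \<le> C * q ^ i"
proof -
  obtain C q where q: "0 < q" "q < 1" and
    *: "\<forall>\<^sub>F n in sequentially. \<forall>i. 0 \<le> w_n c \<gamma> G n i \<and> w_n c \<gamma> G n i \<le> C * q ^ i"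
    by (rule w_n_dominated)
  have "w_lim c \<gamma> G i \<le> C * q ^ i" for i
    by (rule tendsto_upperbound[OF w_n_tendsto]) (use * in \<open>auto elim!: eventually_mono\<close>)
  then show ?thesis using q that by blast
qed

lemma summable_w_lim: "summable (w_lim c \<gamma> G)"
proof -
  obtain C q where q: "0 < q" "q < 1" and *: "\<forall>i. w_lim c \<gamma> G i \<le> C * q ^ i"
    by (rule w_lim_dominated)
  show ?thesis
    by (rule summable_comparison_test'[where g="\<lambda>i. C * q ^ i" and N=0])
      (use q * w_lim_range in \<open>auto intro!: summable_mult summable_geometric simp: less_imp_le\<close>)
qed

end

section \<open>Integrals against atomic measures and vague convergence\<close>

lemma integral_atom_measure:
  fixes f :: "real \<Rightarrow> real"
  assumes "\<And>i. 0 \<le> w i" and "f \<in> borel_measurable borel"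
  shows "integral\<^sup>L (atom_measure w p) f = (\<integral>i. w i * f (p i) \<partial>count_space UNIV)"
  unfolding atom_measure_def using assms
  by (subst integral_distr) (auto simp: integral_density)

lemma compact_supp_bounded:
  assumes "continuous_on UNIV f" "compact_supp f"
  obtains D where "0 \<le> D" "\<forall>x. \<bar>f x\<bar> \<le> D"
proof -
  have "compact (f ` closure {x. f x \<noteq> 0})"
    using assms unfolding compact_supp_def
    by (intro compact_continuous_image) (auto intro: continuous_on_subset)
  then have "bounded (f ` closure {x. f x \<noteq> 0})" by (rule compact_imp_bounded)
  then obtain D where D: "0 < D" "\<And>y. y \<in> f ` closure {x. f x \<noteq> 0} \<Longrightarrow> norm y \<le> D"
    unfolding bounded_pos by blast
  have "\<bar>f x\<bar> \<le> D" for x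
  proof (cases "f x = 0")
    case False
    then have "x \<in> closure {x. f x \<noteq> 0}" by (intro subsetD[OF closure_subset]) simp
    then show ?thesis using D(2)[of "f x"] by auto
  qed (use D in auto)
  then show ?thesis using D(1) by (intro that[of D]) auto
qed

text \<open>The locations p i are the same for every n, so only the weights move and the values of
  the test function act as bounded constant factors.\<close>

lemma (in arrival_times) vague_conv_atoms:
  "vague_conv (\<lambda>n. atom_measure (w_n c \<gamma> G n) p) (atom_measure (w_lim c \<gamma> G) p)"
  unfolding vague_conv_def
proof (intro allI impI, elim conjE)
  fix f assume f: "continuous_on UNIV f" "compact_supp f"
  then obtain D where D: "0 \<le> D" "\<forall>x. \<bar>f x\<bar> \<le> D" by (rule compact_supp_bounded)
  have fm: "f \<in> borel_measurable borel" using f(1) by (rule borel_measurable_continuous_onI)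
  obtain C q where q: "0 < q" "q < 1" and
    dom: "\<forall>\<^sub>F n in sequentially. \<forall>i. 0 \<le> w_n c \<gamma> G n i \<and> w_n c \<gamma> G n i \<le> C * q ^ i"
    by (rule w_n_dominated)
  then obtain N where N: "\<And>n i. n \<ge> N \<Longrightarrow> 0 \<le> w_n c \<gamma> G n i \<and> w_n c \<gamma> G n i \<le> C * q ^ i"
    unfolding eventually_sequentially by blast
  have "(\<lambda>n. \<integral>i. w_n c \<gamma> G (n + N) i * f (p i) \<partial>count_space UNIV) \<longlonglongrightarrow>
      (\<integral>i. w_lim c \<gamma> G i * f (p i) \<partial>count_space UNIV)"
  proof (rule integral_dominated_convergence[where w="\<lambda>i. C * q ^ i * D"])
    have "summable (\<lambda>i. norm (C * q ^ i * D))"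
      using q by (simp add: abs_mult power_abs summable_mult summable_mult2 summable_geometric)
    then show "integrable (count_space UNIV) (\<lambda>i. C * q ^ i * D)"
      by (simp only: integrable_count_space_nat_iff)
    show "AE i in count_space UNIV. (\<lambda>n. w_n c \<gamma> G (n + N) i * f (p i)) \<longlonglongrightarrow> w_lim c \<gamma> G i * f (p i)"
      by (intro AE_I2 tendsto_intros LIMSEQ_ignore_initial_segment[OF w_n_tendsto])
    show "AE i in count_space UNIV. norm (w_n c \<gamma> G (n + N) i * f (p i)) \<le> C * q ^ i * D" for n
      using N[of "n + N"] D
      by (intro AE_I2) (auto simp: abs_mult intro!: mult_mono intro: order_trans)
  qed auto
  moreover have "integral\<^sup>L (atom_measure (w_n c \<gamma> G (n + N)) p) f =
      (\<integral>i. w_n c \<gamma> G (n + N) i * f (p i) \<partial>count_space UNIV)" for n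
    using N[of "n + N"] fm by (intro integral_atom_measure) auto
  moreover have "integral\<^sup>L (atom_measure (w_lim c \<gamma> G) p) f =
      (\<integral>i. w_lim c \<gamma> G i * f (p i) \<partial>count_space UNIV)"
    using w_lim_range fm by (intro integral_atom_measure) (auto simp: less_imp_le)
  ultimately have "(\<lambda>n. integral\<^sup>L (atom_measure (w_n c \<gamma> G (n + N)) p) f) \<longlonglongrightarrow>
      integral\<^sup>L (atom_measure (w_lim c \<gamma> G) p) f" by simp
  then show "(\<lambda>n. integral\<^sup>L (atom_measure (w_n c \<gamma> G n) p) f) \<longlonglongrightarrow>
      integral\<^sup>L (atom_measure (w_lim c \<gamma> G) p) f" by (rule LIMSEQ_offset)
qed

section \<open>The law of large numbers for exponential arrivals\<close>

text \<open>Exponential tilting: the integrand is 1 / (1 - \<theta>) times the exponential density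
  of rate 1 - \<theta>, whose mass is 1.\<close>

lemma nn_integral_exponential_mgf:
  fixes \<theta> :: real
  assumes "\<theta> < 1"
  shows "(\<integral>\<^sup>+t. ennreal (exponential_density 1 t) * ennreal (exp (\<theta> * t)) \<partial>lborel) = ennreal (1 / (1 - \<theta>))"
proof -
  have l: "0 < 1 - \<theta>" using assms by simp
  interpret D: prob_space "density lborel (exponential_density (1 - \<theta>))"
    by (rule prob_space_exponential_density[OF l])
  have 1: "(\<integral>\<^sup>+t. ennreal (exponential_density (1 - \<theta>) t) \<partial>lborel) = 1"
    using D.emeasure_space_1 by (simp add: emeasure_density)
  have "exp (- t) * exp (\<theta> * t) = exp (- t * (1 - \<theta>))" for t
    unfolding exp_add[symmetric] by (simp add: algebra_simps)
  then have "ennreal (exponential_density 1 t) * ennreal (exp (\<theta> * t)) =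
      ennreal (1 / (1 - \<theta>)) * ennreal (exponential_density (1 - \<theta>) t)" for t
    using l by (simp add: exponential_density_def ennreal_mult[symmetric])
  then show ?thesis by (simp add: nn_integral_cmult 1)
qed

locale exp_arrivals = prob_space M for M :: "'a measure" +
  fixes E :: "nat \<Rightarrow> 'a \<Rightarrow> real"
  assumes indep_times: "indep_vars (\<lambda>_. borel) E UNIV"
    and exp_times: "\<And>i. distributed M lborel (E i) (\<lambda>t. ennreal (exponential_density 1 t))"
begin

lemma E_measurable [measurable]: "E i \<in> borel_measurable M"
  using distributed_measurable[OF exp_times[of i]] by simp

lemma Gam_measurable [measurable]: "Gam E i \<in> borel_measurable M"
  unfolding Gam_def[abs_def] by measurable

lemma Gam_mgf:
  fixes \<theta> :: real
  assumes "\<theta> < 1"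
  shows "(\<integral>\<^sup>+x. ennreal (exp (\<theta> * Gam E n x)) \<partial>M) = ennreal ((1 / (1 - \<theta>)) ^ Suc n)"
proof -
  have m: "(\<integral>\<^sup>+x. ennreal (exp (\<theta> * E j x)) \<partial>M) = ennreal (1 / (1 - \<theta>))" for j
    using distributed_nn_integral[OF exp_times[of j], of "\<lambda>t. ennreal (exp (\<theta> * t))"]
      nn_integral_exponential_mgf[OF assms] by simp
  have "(\<integral>\<^sup>+x. ennreal (exp (\<theta> * Gam E n x)) \<partial>M) = (\<integral>\<^sup>+x. (\<Prod>j\<le>n. ennreal (exp (\<theta> * E j x))) \<partial>M)"
    by (simp add: Gam_def sum_distrib_left exp_sum prod_ennreal)
  also have "\<dots> = (\<Prod>j\<le>n. \<integral>\<^sup>+x. ennreal (exp (\<theta> * E j x)) \<partial>M)"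
    by (rule indep_vars_nn_integral)
      (auto intro!: indep_vars_compose2[OF indep_vars_subset[OF indep_times]])
  also have "\<dots> = ennreal ((1 / (1 - \<theta>)) ^ Suc n)"
    unfolding m prod_constant card_atMost using assms by (intro ennreal_power) auto
  finally show ?thesis .
qed

text \<open>Chernoff's bound with the optimal parameter \<open>1 - 1 / a\<close>; its sign selects the upper or
  the lower tail.\<close>

lemma Gam_chernoff:
  fixes a :: real
  assumes a: "0 < a"
  shows "prob {x \<in> space M. 0 \<le> (1 - 1 / a) * (Gam E n x - a * Suc n)} \<le> (a * exp (1 - a)) ^ Suc n"
proof -
  define t where "t = 1 - 1 / a"
  let ?A = "{x \<in> space M. 0 \<le> t * (Gam E n x - a * Suc n)}"
  have t: "t < 1" using a by (simp add: t_def)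
  have A: "?A \<in> sets M" by measurable
  have "emeasure M ?A = (\<integral>\<^sup>+x. indicator ?A x \<partial>M)" using A by simp
  also have "\<dots> \<le> (\<integral>\<^sup>+x. ennreal (exp (- t * a * Suc n)) * ennreal (exp (t * Gam E n x)) \<partial>M)"
  proof (rule nn_integral_mono)
    fix x
    have "1 \<le> exp (t * (Gam E n x - a * Suc n))" if "x \<in> ?A"
      using that by (simp only: mem_Collect_eq one_le_exp_iff)
    moreover have "exp (t * (Gam E n x - a * Suc n)) = exp (- t * a * Suc n) * exp (t * Gam E n x)"
      unfolding exp_add[symmetric] by (rule arg_cong[where f=exp]) (simp only: algebra_simps minus_mult_left[symmetric] mult_minus_right)
    ultimately show "indicator ?A x \<le> ennreal (exp (- t * a * Suc n)) * ennreal (exp (t * Gam E n x))"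
      by (simp only: ennreal_mult[symmetric] exp_ge_zero) (simp add: indicator_def del: mem_Collect_eq)
  qed
  also have "\<dots> = ennreal (exp (- t * a * Suc n)) * ennreal ((1 / (1 - t)) ^ Suc n)"
    by (subst nn_integral_cmult) (simp_all only: Gam_mgf[OF t], measurable)
  also have "\<dots> = ennreal (exp (- t * a * Suc n) * (1 / (1 - t)) ^ Suc n)"
    using t by (intro ennreal_mult[symmetric]) auto
  also have "exp (- t * a * Suc n) = exp (1 - a) ^ Suc n"
    unfolding exp_of_nat_mult[symmetric] using a by (simp add: t_def field_simps)
  also have "(1 / (1 - t)) = a" using a by (simp add: t_def)
  also have "exp (1 - a) ^ Suc n * a ^ Suc n = (a * exp (1 - a)) ^ Suc n"
    by (simp only: power_mult_distrib mult.commute)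
  finally have "ennreal (prob ?A) \<le> ennreal ((a * exp (1 - a)) ^ Suc n)"
    unfolding emeasure_eq_measure .
  moreover have "0 \<le> (a * exp (1 - a)) ^ Suc n" using a by (intro zero_le_power) auto
  ultimately have "prob ?A \<le> (a * exp (1 - a)) ^ Suc n" by (simp only: ennreal_le_iff)
  then show ?thesis by (simp only: t_def)
qed

text \<open>ln a < a - 1 is strict for a different from 1, so the Chernoff bounds form a convergent
  geometric series and Borel-Cantelli applies. For a > 1 the conclusion says that Gam stays below a
  * (n + 1), for a < 1 that it stays above.\<close>

lemma Gam_eventually_on_side:
  fixes a :: real
  assumes a: "0 < a" "a \<noteq> 1"
  shows "AE x in M. \<forall>\<^sub>F n in sequentially. (1 - 1 / a) * (Gam E n x - a * Suc n) < 0"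
proof -
  let ?A = "\<lambda>n. {x \<in> space M. 0 \<le> (1 - 1 / a) * (Gam E n x - a * Suc n)}"
  have "ln a < a - 1" using ln_le_minus_one[OF a(1)] ln_eq_minus_one[OF a(1)] a(2) by force
  then have "exp (ln a) < exp (a - 1)" by (simp only: exp_less_cancel_iff)
  then have "a < exp (a - 1)" using a by simp
  then have "a * exp (1 - a) < exp (a - 1) * exp (1 - a)" by (intro mult_strict_right_mono) auto
  then have q: "a * exp (1 - a) < 1" by (simp add: exp_add[symmetric])
  have "summable (\<lambda>n. (a * exp (1 - a)) ^ Suc n)"
    using q a by (intro summable_ignore_initial_segment[of _ 1, simplified] summable_geometric) auto
  then have s: "summable (\<lambda>n. prob (?A n))"
    by (rule summable_comparison_test'[where N=0]) (use Gam_chernoff[OF a(1)] in auto)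
  have "AE x in M. \<forall>\<^sub>F n in sequentially. x \<in> space M - ?A n"
    by (rule borel_cantelli_AE1[OF _ _ s]) (auto simp: less_top[symmetric])
  then show ?thesis
    by eventually_elim (auto elim!: eventually_mono simp: not_le)
qed

text \<open>Countably many levels 1 + 1 / (k + 2) and 1 - 1 / (k + 2) suffice; the offset 2 keeps
  the lower levels positive.\<close>

lemma Gam_slln: "AE x in M. (\<lambda>n. Gam E n x / real n) \<longlonglongrightarrow> 1"
proof -
  have "AE x in M. \<forall>k. \<forall>\<^sub>F n in sequentially. (1 - 1 / (1 + 1 / real (k + 2))) * (Gam E n x - (1 + 1 / real (k + 2)) * Suc n) < 0"
    unfolding AE_all_countable by (intro allI Gam_eventually_on_side) (auto simp: add_pos_pos)
  moreover have "AE x in M. \<forall>k. \<forall>\<^sub>F n in sequentially. (1 - 1 / (1 - 1 / real (k + 2))) * (Gam E n x - (1 - 1 / real (k + 2)) * Suc n) < 0"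
    unfolding AE_all_countable by (intro allI Gam_eventually_on_side) auto
  ultimately show ?thesis
  proof eventually_elim
    case (elim x)
    have "(\<lambda>n. Gam E n x / Suc n) \<longlonglongrightarrow> 1"
    proof (rule LIMSEQ_I)
      fix r :: real assume "0 < r"
      then obtain k where k: "1 / real (Suc k) < r" using nat_approx_posE by blast
      define e where "e = 1 / real (k + 2)"
      have "e \<le> 1 / real (Suc k)" unfolding e_def by (intro divide_left_mono) auto
      then have e: "0 < e" "e < 1" "e < r"
        using k by (auto simp: e_def)
      have sgn: "1 - 1 / (1 + e) > 0" "1 - 1 / (1 - e) < 0" using e by (auto simp: field_simps)
      have "\<forall>\<^sub>F n in sequentially. (1 - 1 / (1 + e)) * (Gam E n x - (1 + e) * Suc n) < 0"
        "\<forall>\<^sub>F n in sequentially. (1 - 1 / (1 - e)) * (Gam E n x - (1 - e) * Suc n) < 0"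
        using elim unfolding e_def by blast+
      then have "\<forall>\<^sub>F n in sequentially. norm (Gam E n x / Suc n - 1) < r"
      proof eventually_elim
        case (elim n)
        then have "Gam E n x < (1 + e) * Suc n" "(1 - e) * Suc n < Gam E n x"
          using sgn by (auto simp: mult_less_0_iff)
        then have "Gam E n x / Suc n < 1 + e" "1 - e < Gam E n x / Suc n"
          by (auto simp: pos_divide_less_eq pos_less_divide_eq)
        then show ?case using e by (simp add: abs_less_iff)
      qed
      then show "\<exists>N. \<forall>n\<ge>N. norm (Gam E n x / Suc n - 1) < r" by (simp add: eventually_sequentially)
    qed
    \<comment> \<open>\<open>Gam E n\<close> has n + 1 summands, so the limit was first obtained for
      the quotient by \<open>Suc n\<close>.\<close>
    moreover have "(\<lambda>n. Suc n / real n) \<longlonglongrightarrow> 1" by (rule LIMSEQ_Suc_n_over_n)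
    ultimately have "(\<lambda>n. (Gam E n x / Suc n) * (Suc n / real n)) \<longlonglongrightarrow> 1 * 1"
      by (rule tendsto_mult)
    then show ?case by (simp del: of_nat_Suc)
  qed
qed

lemma Gam_arrival_times: 
  assumes "0 < c" "0 < \<gamma>"
  shows "AE x in M. arrival_times (\<lambda>i. Gam E i x) c \<gamma>"
proof -
  have "AE x in M. 0 < E i x" for i
  proof -
    \<comment> \<open>\<open>exponential_density 1\<close> is positive at 0 itself, so strict
      positivity of the waiting times needs this null point removed.\<close>
    have "AE t in lborel. t \<noteq> (0::real)" by (rule AE_lborel_singleton)
    then have "AE t in density lborel (exponential_density 1). 0 < t"
      by (auto simp: AE_density exponential_density_def elim!: eventually_mono)
    then show ?thesis
      unfolding distributed_distr_eq_density[OF exp_times[of i], symmetric] by (subst (asm) AE_distr_iff) auto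
  qed
  then have "AE x in M. \<forall>i. 0 < E i x" by (simp add: AE_all_countable)
  with Gam_slln show ?thesis
  proof eventually_elim
    case (elim x)
    show ?case
    proof
      show "0 < Gam E i x" for i unfolding Gam_def using elim by (intro sum_pos) auto
      show "strict_mono (\<lambda>i. Gam E i x)" unfolding strict_mono_Suc_iff Gam_def using elim by simp
    qed (use assms elim in auto)
  qed
qed

end

section \<open>The Levy exponent and the inverse of the limiting tail\<close>

definition levy :: "real \<Rightarrow> real \<Rightarrow> real \<Rightarrow> real" where
  "levy c t s = (1 - exp (- t * s)) * c * s powr (-1) * (1 - s) powr (c - 1)"

definition levy_tail :: "real \<Rightarrow> real \<Rightarrow> real \<Rightarrow> real" where
  "levy_tail c t y = (LBINT s=y..1. levy c t s)"

definition levy_exponent :: "real \<Rightarrow> real \<Rightarrow> real" where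
  "levy_exponent c t = (LBINT s=0..1. levy c t s)"

text \<open>The estimate 1 - exp (- t * s) \<le> t * s cancels the factor 1 / s and leaves a
  multiple of the Beta(1, c) integrand.\<close>

lemma levy_integrable:
  assumes c: "0 < c" and t: "0 \<le> t"
  shows "set_integrable lborel {0<..<1} (levy c t)"
proof (rule set_integrable_bound[OF set_integrable_mult_right[OF Beta_integral_lborel(1)[OF zero_less_one c], of "t * c"]])
  show "set_borel_measurable lborel {0<..<1} (levy c t)"
    unfolding set_borel_measurable_def levy_def[abs_def] by measurable
  show "AE s in lborel. s \<in> {0<..<1} \<longrightarrow>
      norm (levy c t s) \<le> norm (t * c * (s powr (1 - 1) * (1 - s) powr (c - 1)))"
  proof (intro AE_I2 impI)
    fix s :: real assume s: "s \<in> {0<..<1}"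
    have "1 - exp (- t * s) \<le> t * s" using exp_ge_add_one_self[of "- t * s"] by simp
    then have "(1 - exp (- t * s)) * (c * (1 - s) powr (c - 1) / s) \<le> t * s * (c * (1 - s) powr (c - 1) / s)"
      using c s by (intro mult_right_mono) auto
    moreover have "0 \<le> 1 - exp (- t * s)" using t s by simp
    ultimately show "norm (levy c t s) \<le> norm (t * c * (s powr (1 - 1) * (1 - s) powr (c - 1)))"
      using c t s by (simp add: levy_def powr_minus_divide abs_mult field_simps)
  qed
qed

text \<open>For t > 0 the integrand is a tail density of finite mass. At t = 0 it vanishes and
  positivity fails; proving all four facts together makes this case distinction only once.\<close>

lemma levy_tail_props:
  assumes c: "0 < c" and t: "0 \<le> t"
  shows DERIV_levy_tail: "0 < y \<Longrightarrow> y < 1 \<Longrightarrow> (levy_tail c t has_real_derivative - levy c t y) (at y)"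
    and levy_tail_range: "0 < y \<Longrightarrow> y < 1 \<Longrightarrow> 0 \<le> levy_tail c t y \<and> levy_tail c t y \<le> levy_exponent c t"
    and levy_tail_at_1: "(levy_tail c t \<longlongrightarrow> 0) (at_left 1)"
    and levy_tail_at_0: "(levy_tail c t \<longlongrightarrow> levy_exponent c t) (at_right 0)"
proof -
  have "(0 < y \<longrightarrow> y < 1 \<longrightarrow> (levy_tail c t has_real_derivative - levy c t y) (at y)) \<and>
    (0 < y \<longrightarrow> y < 1 \<longrightarrow> 0 \<le> levy_tail c t y \<and> levy_tail c t y \<le> levy_exponent c t) \<and>
    (levy_tail c t \<longlongrightarrow> 0) (at_left 1) \<and>
    (levy_tail c t \<longlongrightarrow> levy_exponent c t) (at_right 0)" for y
  proof (cases "t = 0")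
    case True
    then have "levy c t = (\<lambda>_. 0)" "levy_tail c t = (\<lambda>_. 0)" "levy_exponent c t = 0"
      by (simp_all add: levy_def levy_tail_def levy_exponent_def fun_eq_iff)
    then show ?thesis by simp
  next
    case False
    interpret tail_density "levy c t"
    proof
      show "continuous_on {0<..<1} (levy c t)"
        unfolding levy_def[abs_def] by (intro continuous_intros) auto
      show "0 < levy c t s" if "0 < s" "s < 1" for s
        using that c t False by (simp add: levy_def)
      show "set_integrable lborel {x<..<1} (levy c t)" if "0 < x" "x < 1" for x
        by (rule set_integrable_subset[OF levy_integrable[OF c t]]) (use that in auto)
    qed
    have T: "T = levy_tail c t" by (rule ext) (simp add: T_def levy_tail_def)
    have L: "levy_exponent c t = (LBINT s:{0<..<1}. levy c t s)"
      unfolding levy_exponent_def by (subst interval_integral_Ioo) (auto simp: zero_ereal_def one_ereal_def)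
    have im: "T ` {0<..<1} = {0<..<levy_exponent c t}"
      unfolding L by (rule range_T_finite[OF levy_integrable[OF c t]])
    have 1: "(T \<longlongrightarrow> 0) (at_left 1)"
    proof (rule order_tendstoI)
      fix a :: real assume "a < 0"
      have "\<forall>\<^sub>F x in at_left 1. x \<in> {0<..<1::real}" by (rule eventually_at_leftI[of 0]) auto
      then show "\<forall>\<^sub>F x in at_left 1. a < T x"
        by eventually_elim (use T_pos \<open>a < 0\<close> in force)
    next
      fix a :: real assume "0 < a"
      then obtain z where z: "0 < z" "z < 1" "T z < a" using T_small[of a] by auto
      have "\<forall>\<^sub>F x in at_left 1. x \<in> {z<..<1::real}" by (rule eventually_at_leftI[of z]) (use z in auto)
      then show "\<forall>\<^sub>F x in at_left 1. T x < a"
        by eventually_elim (use T_less[of z] z in force)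
    qed
    have 2: "(T \<longlongrightarrow> levy_exponent c t) (at_right 0)"
    proof (rule order_tendstoI)
      fix a :: real assume "levy_exponent c t < a"
      have "\<forall>\<^sub>F x in at_right 0. x \<in> {0<..<1::real}" by (rule eventually_at_rightI[of _ 1]) auto
      then show "\<forall>\<^sub>F x in at_right 0. T x < a"
      proof eventually_elim
        case (elim x)
        then have "T x \<in> {0<..<levy_exponent c t}" unfolding im[symmetric] by (rule imageI)
        then show ?case using \<open>levy_exponent c t < a\<close> by simp
      qed
    next
      fix a :: real assume a: "a < levy_exponent c t"
      have "0 < levy_exponent c t" using imageI[of "1/2" "{0<..<1}" T] unfolding im by auto
      \<comment> \<open>Replacing a by this maximum yields a positive level below the total mass,
        hence a value of T.\<close>
      then have "max a (levy_exponent c t / 2) \<in> {0<..<levy_exponent c t}" using a by auto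
      then have "max a (levy_exponent c t / 2) \<in> T ` {0<..<1}" unfolding im .
      then obtain z where z: "0 < z" "z < 1" "a \<le> T z" by force
      have "\<forall>\<^sub>F x in at_right 0. x \<in> {0<..<z}" by (rule eventually_at_rightI[of _ z]) (use z in auto)
      then show "\<forall>\<^sub>F x in at_right 0. a < T x"
        by eventually_elim (use T_less[of _ z] z in force)
    qed
    have "T y \<in> {0<..<levy_exponent c t}" if "0 < y" "y < 1"
      unfolding im[symmetric] using that by (intro imageI) auto
    then show ?thesis using DERIV_T[of y] 1 2 unfolding T by auto
  qed
  then show "0 < y \<Longrightarrow> y < 1 \<Longrightarrow> (levy_tail c t has_real_derivative - levy c t y) (at y)"
    "0 < y \<Longrightarrow> y < 1 \<Longrightarrow> 0 \<le> levy_tail c t y \<and> levy_tail c t y \<le> levy_exponent c t"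
    "(levy_tail c t \<longlongrightarrow> 0) (at_left 1)"
    "(levy_tail c t \<longlongrightarrow> levy_exponent c t) (at_right 0)"
    by blast+
qed

abbreviation (input) mu_inv :: "real \<Rightarrow> real \<Rightarrow> real \<Rightarrow> real" where
  "mu_inv c \<gamma> \<equiv> the_inv_into {0<..<1} (mu_lim c \<gamma>)"

section \<open>Regularity and boundary behaviour of the inverse of the limiting tail\<close>

context
  fixes c \<gamma> :: real
  assumes c: "0 < c" and g: "0 < \<gamma>"
begin

lemma mu_inv_range: "0 < r \<Longrightarrow> 0 < mu_inv c \<gamma> r \<and> mu_inv c \<gamma> r < 1"
  using mu_lim_inv(2)[OF c g] by auto

lemma isCont_mu_inv:
  assumes r: "0 < r"
  shows "isCont (mu_inv c \<gamma>) r"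
  unfolding isCont_def
proof (rule order_tendstoI)
  note m = mu_inv_range[OF r]
  have pos: "\<forall>\<^sub>F x in at r. 0 < x"
    using r by (intro order_tendstoD(1)[OF tendsto_ident_at])
  {
    fix a assume a: "a < mu_inv c \<gamma> r"
    define y where "y = max a (mu_inv c \<gamma> r / 2)"
    have y: "0 < y" "y < 1" "y < mu_inv c \<gamma> r" "a \<le> y" unfolding y_def using a m by auto
    then have "r < mu_lim c \<gamma> y" using mu_lim_inv(4)[OF c g r] by auto
    from order_tendstoD(2)[OF tendsto_ident_at this] pos
    show "\<forall>\<^sub>F x in at r. a < mu_inv c \<gamma> x"
      by eventually_elim (use mu_lim_inv(4)[OF c g _ y(1,2)] y in force)
  next
    fix a assume a: "mu_inv c \<gamma> r < a"
    define y where "y = min a ((mu_inv c \<gamma> r + 1) / 2)"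
    have y: "0 < y" "y < 1" "mu_inv c \<gamma> r < y" "y \<le> a"
      unfolding y_def using a m by (auto simp: min_less_iff_disj)
    then have "mu_lim c \<gamma> y < r" using mu_lim_inv(3)[OF c g r] by auto
    from order_tendstoD(1)[OF tendsto_ident_at this] pos
    show "\<forall>\<^sub>F x in at r. mu_inv c \<gamma> x < a"
      by eventually_elim (use mu_lim_inv(3)[OF c g _ y(1,2)] y in force)
  }
qed

lemma DERIV_mu_lim: "0 < y \<Longrightarrow> y < 1 \<Longrightarrow>
  (mu_lim c \<gamma> has_real_derivative - (c * \<gamma> * (y powr (-1) * (1 - y) powr (c - 1)))) (at y)"
proof -
  assume y: "0 < y" "y < 1"
  interpret tail_density "\<lambda>s. c * \<gamma> * (s powr (0 - 1) * (1 - s) powr (c - 1))"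
    by (rule tail_density_beta) (use c g in auto)
  show ?thesis using DERIV_T[OF y] unfolding mu_lim_eq_T[OF c g] by (simp only: diff_0)
qed

lemma DERIV_mu_inv:
  assumes r: "0 < r"
  shows "(mu_inv c \<gamma> has_real_derivative
    inverse (- (c * \<gamma> * (mu_inv c \<gamma> r powr (-1) * (1 - mu_inv c \<gamma> r) powr (c - 1))))) (at r)"
proof (rule DERIV_inverse_function[where a=0 and b="r + 1"])
  note m = mu_inv_range[OF r]
  show "(mu_lim c \<gamma> has_real_derivative
    - (c * \<gamma> * (mu_inv c \<gamma> r powr (-1) * (1 - mu_inv c \<gamma> r) powr (c - 1)))) (at (mu_inv c \<gamma> r))"
    by (rule DERIV_mu_lim) (use m in auto)
  show "- (c * \<gamma> * (mu_inv c \<gamma> r powr (-1) * (1 - mu_inv c \<gamma> r) powr (c - 1))) \<noteq> 0"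
    using m c g by auto
  show "mu_lim c \<gamma> (mu_inv c \<gamma> y) = y" if "0 < y" "y < r + 1" for y
    using mu_lim_inv(1)[OF c g that(1)] .
qed (use r isCont_mu_inv in auto)

text \<open>Here and in \<open>mu_inv_at_top\<close> the end of (0, 1) is approached from inside, to
  compose with the one-sided limits of \<open>levy_tail\<close>. The end 1 belongs to time 0, the
  end 0 to time infinity.\<close>

lemma mu_inv_at_0: "filterlim (mu_inv c \<gamma>) (at_left 1) (at_right 0)"
proof (rule tendsto_imp_filterlim_at_left)
  have pos: "\<forall>\<^sub>F x in at_right 0. 0 < (x :: real)" by (rule eventually_at_rightI[of _ 1]) auto
  show lt: "\<forall>\<^sub>F x in at_right 0. mu_inv c \<gamma> x < 1"
    using pos by eventually_elim (use mu_inv_range in auto)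
  show "(mu_inv c \<gamma> \<longlongrightarrow> 1) (at_right 0)"
  proof (rule order_tendstoI)
    fix a :: real assume "a < 1"
    then obtain y where y: "0 < y" "y < 1" "a \<le> y" using that[of "max a (1/2)"] by auto
    have "0 < mu_lim c \<gamma> y" using mu_lim_image[OF c g] y(1,2) by (metis greaterThanLessThan_iff greaterThan_iff imageI)
    then have "\<forall>\<^sub>F x in at_right 0. x \<in> {0<..<mu_lim c \<gamma> y}"
      by (intro eventually_at_rightI[of _ "mu_lim c \<gamma> y"]) auto
    then show "\<forall>\<^sub>F x in at_right 0. a < mu_inv c \<gamma> x"
      by eventually_elim (use mu_lim_inv(4)[OF c g _ y(1,2)] y in force)
  next
    fix a :: real assume "1 < a"
    from lt show "\<forall>\<^sub>F x in at_right 0. mu_inv c \<gamma> x < a"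
      by eventually_elim (use \<open>1 < a\<close> in auto)
  qed
qed

lemma mu_inv_at_top: "filterlim (mu_inv c \<gamma>) (at_right 0) at_top"
proof (rule tendsto_imp_filterlim_at_right)
  show gt: "\<forall>\<^sub>F x in at_top. 0 < mu_inv c \<gamma> x"
    using eventually_gt_at_top[of 0] by eventually_elim (use mu_inv_range in auto)
  show "(mu_inv c \<gamma> \<longlongrightarrow> 0) at_top"
  proof (rule order_tendstoI)
    fix a :: real assume "0 < a"
    then obtain y where y: "0 < y" "y < 1" "y \<le> a" using that[of "min a (1/2)"] by auto
    show "\<forall>\<^sub>F x in at_top. mu_inv c \<gamma> x < a"
      using eventually_gt_at_top[of 0] eventually_gt_at_top[of "mu_lim c \<gamma> y"]
      by eventually_elim (use mu_lim_inv(3)[OF c g _ y(1,2)] y in force)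
  next
    fix a :: real assume "a < 0"
    from gt show "\<forall>\<^sub>F x in at_top. a < mu_inv c \<gamma> x"
      by eventually_elim (use \<open>a < 0\<close> in auto)
  qed
qed

text \<open>Off the image, \<open>the_inv_into\<close> returns one fixed default value. Being
  constant there, the inverse is Borel measurable on the whole line.\<close>

lemma mu_inv_outside: "r \<le> 0 \<Longrightarrow> mu_inv c \<gamma> r = (THE y. False)"
proof -
  assume r: "r \<le> 0"
  have "(\<lambda>y. y \<in> {0<..<1} \<and> mu_lim c \<gamma> y = r) = (\<lambda>y. False)"
    using mu_lim_image[OF c g] r by (metis greaterThan_iff imageI not_less)
  then show ?thesis unfolding the_inv_into_def by (simp only:)
qed

lemma mu_inv_measurable: "mu_inv c \<gamma> \<in> borel_measurable borel"
proof -
  have "continuous_on {0<..} (mu_inv c \<gamma>)"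
    by (intro continuous_at_imp_continuous_on ballI isCont_mu_inv) auto
  then have "(\<lambda>r. indicator {0<..} r *\<^sub>R mu_inv c \<gamma> r) \<in> borel_measurable borel"
    by (intro borel_measurable_continuous_on_indicator) auto
  then have "(\<lambda>r. if 0 < r then indicator {0<..} r *\<^sub>R mu_inv c \<gamma> r else (THE y. False)) \<in> borel_measurable borel"
    by measurable
  also have "(\<lambda>r. if 0 < r then indicator {0<..} r *\<^sub>R mu_inv c \<gamma> r else (THE y. False)) = mu_inv c \<gamma>"
    by (auto simp: fun_eq_iff mu_inv_outside indicator_def)
  finally show ?thesis .
qed

end

section \<open>The Laplace fixed point equation\<close>

text \<open>p j is the probability that a mark falls into the j-th of several disjoint sets. The
  form 1 minus a sum accounts for marks outside all of them, which contribute exp 0 = 1.\<close>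

definition lap_h :: "real \<Rightarrow> real \<Rightarrow> 'i set \<Rightarrow> ('i \<Rightarrow> real) \<Rightarrow> ('i \<Rightarrow> real) \<Rightarrow> real \<Rightarrow> real" where
  "lap_h c \<gamma> I p t s = 1 - (\<Sum>j\<in>I. p j * (1 - exp (- t j * mu_inv c \<gamma> s)))"

text \<open>\<open>lap_V s\<close> is the Laplace functional of the marked process restricted to the arrival times
  after \<open>s\<close>, that is \<open>exp (- LINT r:{s<..}. 1 - lap_h r)\<close>; the substitution \<open>r = mu_lim y\<close> turns
  the exponent into levy integrals. The case distinction supplies the value \<open>mu_inv 0 = 1\<close>, which
  \<^const>\<open>the_inv_into\<close> leaves unspecified.\<close>

definition lap_V :: "real \<Rightarrow> real \<Rightarrow> 'i set \<Rightarrow> ('i \<Rightarrow> real) \<Rightarrow> ('i \<Rightarrow> real) \<Rightarrow> real \<Rightarrow> real" where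
  "lap_V c \<gamma> I p t s = exp (- (\<Sum>j\<in>I. \<gamma> * p j *
     (levy_exponent c (t j) - (if s \<le> 0 then 0 else levy_tail c (t j) (mu_inv c \<gamma> s)))))"

context
  fixes c \<gamma> :: real and I :: "'i set" and p t :: "'i \<Rightarrow> real"
  assumes c: "0 < c" and g: "0 < \<gamma>"
    and p: "\<And>j. j \<in> I \<Longrightarrow> 0 \<le> p j" and p1: "(\<Sum>j\<in>I. p j) \<le> 1"
    and t: "\<And>j. j \<in> I \<Longrightarrow> 0 \<le> t j"
begin

lemma lap_h_range:
  assumes "0 < s"
  shows "0 \<le> lap_h c \<gamma> I p t s" "lap_h c \<gamma> I p t s \<le> 1"
proof -
  note m = mu_inv_range[OF c g assms]
  have "(\<Sum>j\<in>I. p j * (1 - exp (- t j * mu_inv c \<gamma> s))) \<le> (\<Sum>j\<in>I. p j)"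
    using p by (intro sum_mono) (simp add: mult_left_le)
  then show "0 \<le> lap_h c \<gamma> I p t s" unfolding lap_h_def using p1 by simp
  have "0 \<le> (\<Sum>j\<in>I. p j * (1 - exp (- t j * mu_inv c \<gamma> s)))"
    using p t m by (intro sum_nonneg mult_nonneg_nonneg) auto
  then show "lap_h c \<gamma> I p t s \<le> 1" unfolding lap_h_def by simp
qed

lemma lap_V_pos: "0 < lap_V c \<gamma> I p t s"
  by (simp add: lap_V_def)

lemma levy_exponent_nonneg: "j \<in> I \<Longrightarrow> 0 \<le> levy_exponent c (t j)"
  using levy_tail_range[OF c t, of j "1/2"] by simp

lemma lap_V_le_1: "lap_V c \<gamma> I p t s \<le> 1"
proof -
  have "0 \<le> (\<Sum>j\<in>I. \<gamma> * p j *
     (levy_exponent c (t j) - (if s \<le> 0 then 0 else levy_tail c (t j) (mu_inv c \<gamma> s))))"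
  proof (intro sum_nonneg mult_nonneg_nonneg)
    fix j assume j: "j \<in> I"
    show "0 \<le> levy_exponent c (t j) - (if s \<le> 0 then 0 else levy_tail c (t j) (mu_inv c \<gamma> s))"
      using levy_exponent_nonneg[OF j] levy_tail_range[OF c t[OF j], of "mu_inv c \<gamma> s"] mu_inv_range[OF c g, of s]
      by auto
  qed (use g p in auto)
  then show ?thesis by (simp add: lap_V_def)
qed

text \<open>The density of the Levy measure occurs in the derivative of \<open>levy_tail\<close>
  and, inverted, in that of \<open>mu_inv\<close>. It cancels, which leaves (1 - exp (- t j * mu_inv
  s)) / \<gamma> for each j.\<close>

lemma DERIV_lap_V:
  assumes s: "0 < s"
  shows "(lap_V c \<gamma> I p t has_real_derivative (1 - lap_h c \<gamma> I p t s) * lap_V c \<gamma> I p t s) (at s)"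
proof -
  let ?m = "mu_inv c \<gamma>"
  let ?W = "\<lambda>s. exp (- (\<Sum>j\<in>I. \<gamma> * p j * (levy_exponent c (t j) - levy_tail c (t j) (?m s))))"
  note m = mu_inv_range[OF c g s]
  define k where "k = ?m s powr (-1) * (1 - ?m s) powr (c - 1)"
  have k: "0 < k" unfolding k_def using m by auto
  have d: "((\<lambda>s. levy_tail c (t j) (?m s)) has_real_derivative (1 - exp (- t j * ?m s)) / \<gamma>) (at s)"
    if "j \<in> I" for j
  proof -
    have "((\<lambda>s. levy_tail c (t j) (?m s)) has_real_derivative
        - levy c (t j) (?m s) * inverse (- (c * \<gamma> * k))) (at s)"
      unfolding k_def using m
      by (intro DERIV_chain2[OF DERIV_levy_tail[OF c t[OF that]] DERIV_mu_inv[OF c g s]]) auto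
    moreover have "levy c (t j) (?m s) = (1 - exp (- t j * ?m s)) * c * k"
      by (simp add: levy_def k_def)
    ultimately have "((\<lambda>s. levy_tail c (t j) (?m s)) has_real_derivative
        - ((1 - exp (- t j * ?m s)) * c * k) * inverse (- (c * \<gamma> * k))) (at s)" by simp
    also have "- ((1 - exp (- t j * ?m s)) * c * k) * inverse (- (c * \<gamma> * k)) = (1 - exp (- t j * ?m s)) / \<gamma>"
      using k c g by (simp add: divide_simps)
    finally show ?thesis .
  qed
  have "((\<lambda>s. - (\<Sum>j\<in>I. \<gamma> * p j * (levy_exponent c (t j) - levy_tail c (t j) (?m s)))) has_real_derivative
      - (\<Sum>j\<in>I. \<gamma> * p j * (0 - (1 - exp (- t j * ?m s)) / \<gamma>))) (at s)"
    by (intro DERIV_minus DERIV_sum DERIV_cmult DERIV_diff DERIV_const d)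
  also have "- (\<Sum>j\<in>I. \<gamma> * p j * (0 - (1 - exp (- t j * ?m s)) / \<gamma>)) = 1 - lap_h c \<gamma> I p t s"
    unfolding lap_h_def sum_negf[symmetric] using g by (simp add: sum_negf[symmetric])
  finally have "(?W has_real_derivative ?W s * (1 - lap_h c \<gamma> I p t s)) (at s)"
    by (rule DERIV_fun_exp)
  moreover have "?W x = lap_V c \<gamma> I p t x" if "0 < x" for x
    using that by (simp add: lap_V_def)
  ultimately have "(?W has_real_derivative (1 - lap_h c \<gamma> I p t s) * lap_V c \<gamma> I p t s) (at s)"
    using s by (simp only: mult.commute)
  then show ?thesis
    by (rule has_field_derivative_transform_within_open[where S="{0<..}"]) (use s in \<open>auto simp: lap_V_def\<close>)
qed

text \<open>At s = 0 this says that the value set by hand is the right one: \<open>mu_inv\<close>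
  tends to 1 there and \<open>levy_tail\<close> to 0.\<close>

lemma lap_V_at_right:
  assumes "0 \<le> s"
  shows "(lap_V c \<gamma> I p t \<longlongrightarrow> lap_V c \<gamma> I p t s) (at_right s)"
proof (cases "s = 0")
  case False
  then have "isCont (lap_V c \<gamma> I p t) s"
    using assms by (intro DERIV_isCont[OF DERIV_lap_V]) auto
  then show ?thesis by (auto simp: continuous_at filterlim_at_split)
next
  case True
  have "((\<lambda>s. exp (- (\<Sum>j\<in>I. \<gamma> * p j * (levy_exponent c (t j) - levy_tail c (t j) (mu_inv c \<gamma> s))))) \<longlongrightarrow>
      exp (- (\<Sum>j\<in>I. \<gamma> * p j * (levy_exponent c (t j) - 0)))) (at_right 0)"
    by (intro tendsto_intros filterlim_compose[OF levy_tail_at_1[OF c t] mu_inv_at_0[OF c g]])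
  moreover have "\<forall>\<^sub>F s in at_right 0. 0 < (s :: real)" by (rule eventually_at_rightI[of _ 1]) auto
  ultimately have "(lap_V c \<gamma> I p t \<longlongrightarrow> exp (- (\<Sum>j\<in>I. \<gamma> * p j * (levy_exponent c (t j) - 0)))) (at_right 0)"
    by (rule Lim_transform_eventually[OF _ eventually_mono]) (simp add: lap_V_def)
  then show ?thesis using True by (simp add: lap_V_def)
qed

lemma lap_V_at_top: "(lap_V c \<gamma> I p t \<longlongrightarrow> 1) at_top"
proof -
  have "((\<lambda>s. exp (- (\<Sum>j\<in>I. \<gamma> * p j * (levy_exponent c (t j) - levy_tail c (t j) (mu_inv c \<gamma> s))))) \<longlongrightarrow>
      exp (- (\<Sum>j\<in>I. \<gamma> * p j * (levy_exponent c (t j) - levy_exponent c (t j))))) at_top"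
    by (intro tendsto_intros filterlim_compose[OF levy_tail_at_0[OF c t] mu_inv_at_top[OF c g]])
  from Lim_transform_eventually[OF this eventually_mono[OF eventually_gt_at_top[of 0]]]
  show ?thesis by (simp add: lap_V_def)
qed

lemma lap_V_measurable: "lap_V c \<gamma> I p t \<in> borel_measurable borel"
proof -
  let ?V = "lap_V c \<gamma> I p t"
  have "continuous_on {0<..} ?V"
    by (intro continuous_at_imp_continuous_on ballI DERIV_isCont[OF DERIV_lap_V]) auto
  then have "(\<lambda>s. indicator {0<..} s *\<^sub>R ?V s) \<in> borel_measurable borel"
    by (intro borel_measurable_continuous_on_indicator) auto
  then have "(\<lambda>s. if 0 < s then indicator {0<..} s *\<^sub>R ?V s else ?V 0) \<in> borel_measurable borel"
    by measurable
  also have "(\<lambda>s. if 0 < s then indicator {0<..} s *\<^sub>R ?V s else ?V 0) = ?V"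
    by (auto simp: fun_eq_iff lap_V_def indicator_def)
  finally show ?thesis .
qed

text \<open>By V' = (1 - h) V the terms without h cancel in the derivative of - exp (- r) * V (s +
  r), leaving the integrand. The boundary values are - V s at r = 0 and 0 at infinity; nonnegativity
  of the integrand yields integrability as well.\<close>

lemma lap_V_eq_integral:
  assumes s: "0 \<le> s"
  shows "(\<integral>\<^sup>+e. ennreal (lap_h c \<gamma> I p t (s + e) * lap_V c \<gamma> I p t (s + e))
    \<partial>density lborel (\<lambda>e. ennreal (exponential_density 1 e))) = ennreal (lap_V c \<gamma> I p t s)"
proof -
  let ?V = "lap_V c \<gamma> I p t" and ?h = "lap_h c \<gamma> I p t"
  let ?F = "\<lambda>r. - (exp (- r) * ?V (s + r))"
  let ?f = "\<lambda>r. exp (- r) * ?h (s + r) * ?V (s + r)"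
  have D: "(?F has_real_derivative ?f r) (at r)" if "0 < r" for r
  proof -
    have "((\<lambda>r. ?V (s + r)) has_real_derivative (1 - ?h (s + r)) * ?V (s + r) * (0 + 1)) (at r)"
      using that s by (intro DERIV_chain2[OF DERIV_lap_V] DERIV_add DERIV_const DERIV_ident) auto
    then have "((\<lambda>r. ?V (s + r)) has_real_derivative (1 - ?h (s + r)) * ?V (s + r)) (at r)" by simp
    moreover have "((\<lambda>r. exp (- r)) has_real_derivative - exp (- r)) (at r)"
      by (auto intro!: derivative_eq_intros)
    ultimately have "(?F has_real_derivative
        - (- exp (- r) * ?V (s + r) + (1 - ?h (s + r)) * ?V (s + r) * exp (- r))) (at r)"
      by (intro DERIV_minus DERIV_mult)
    also have "- (- exp (- r) * ?V (s + r) + (1 - ?h (s + r)) * ?V (s + r) * exp (- r)) = ?f r"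
      by (simp add: algebra_simps)
    finally show ?thesis .
  qed
  have C: "isCont ?f r" if "0 < r" for r
  proof -
    have sr: "isCont (\<lambda>r. s + r) r" by (intro continuous_intros)
    have 1: "isCont (\<lambda>r. ?V (s + r)) r"
      by (rule isCont_o2[OF sr DERIV_isCont[OF DERIV_lap_V]]) (use that s in auto)
    have "isCont ?h x" if "0 < x" for x
      unfolding lap_h_def[abs_def] using isCont_mu_inv[OF c g that] by (intro continuous_intros)
    then have "isCont ?h (s + r)" using that s by simp
    then have "isCont (\<lambda>r. ?h (s + r)) r" by (rule isCont_o2[OF sr])
    with 1 show ?thesis by (intro continuous_intros)
  qed
  have N: "0 \<le> ?f r" if "0 < r" for r
    using lap_h_range(1)[of "s + r"] lap_V_pos[of "s + r"] that s by simp
  have sh: "filterlim (\<lambda>r. s + r) (at_right s) (at_right 0)"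
  proof (rule tendsto_imp_filterlim_at_right)
    show "((\<lambda>r. s + r) \<longlongrightarrow> s) (at_right 0)" by (auto intro!: tendsto_eq_intros)
    show "\<forall>\<^sub>F r in at_right 0. s < s + r" by (rule eventually_at_rightI[of _ 1]) auto
  qed
  have "(?F \<longlongrightarrow> - (exp (- 0) * ?V s)) (at_right 0)"
    by (intro tendsto_intros filterlim_compose[OF lap_V_at_right[OF s] sh])
  then have A: "((?F \<circ> real_of_ereal) \<longlongrightarrow> - ?V s) (at_right (ereal 0))"
    unfolding ereal_tendsto_simps by simp
  have "filterlim (\<lambda>r. s + r) at_top at_top"
    by (rule filterlim_tendsto_add_at_top[OF tendsto_const filterlim_ident])
  then have "((\<lambda>r. ?V (s + r)) \<longlongrightarrow> 1) at_top"
    by (rule filterlim_compose[OF lap_V_at_top])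
  moreover have "((\<lambda>r::real. exp (- r)) \<longlongrightarrow> 0) at_top"
    by (rule filterlim_compose[OF exp_at_bot filterlim_uminus_at_bot_at_top])
  ultimately have "(?F \<longlongrightarrow> - (0 * 1)) at_top" by (intro tendsto_intros)
  then have B: "((?F \<circ> real_of_ereal) \<longlongrightarrow> 0) (at_left \<infinity>)"
    unfolding ereal_tendsto_simps by simp
  note FTC = interval_integral_FTC_nonneg[of "ereal 0" \<infinity> ?F ?f, OF _ D C _ A B]
  have i: "set_integrable lborel {0<..} ?f"
    using FTC(1) N by (simp add: einterval_def greaterThan_def)
  have "(LBINT r=ereal 0..\<infinity>. ?f r) = 0 - (- ?V s)" by (rule FTC(2)) (use N in auto)
  then have e: "(LBINT r:{0<..}. ?f r) = ?V s"
    by (simp add: interval_lebesgue_integral_def einterval_def greaterThan_def)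
  note [measurable] = mu_inv_measurable[OF c g]
  have hm: "?h \<in> borel_measurable borel"
    unfolding lap_h_def[abs_def] by measurable
  have "(\<integral>\<^sup>+e. ennreal (?h (s + e) * ?V (s + e)) \<partial>density lborel (\<lambda>e. ennreal (exponential_density 1 e))) =
      (\<integral>\<^sup>+e. ennreal (exponential_density 1 e) * ennreal (?h (s + e) * ?V (s + e)) \<partial>lborel)"
    using hm lap_V_measurable by (subst nn_integral_density) auto
  also have "\<dots> = (\<integral>\<^sup>+e. ennreal (indicator {0<..} e *\<^sub>R ?f e) \<partial>lborel)"
  proof (rule nn_integral_cong_AE)
    \<comment> \<open>At e = 0 the exponential density is 1 while the indicator of {0<..} is
      0.\<close>
    have "AE e in lborel. e \<noteq> (0::real)" by (rule AE_lborel_singleton)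
    then show "AE e in lborel. ennreal (exponential_density 1 e) * ennreal (?h (s + e) * ?V (s + e)) =
        ennreal (indicator {0<..} e *\<^sub>R ?f e)"
    proof eventually_elim
      case (elim e)
      then show ?case
        using lap_h_range(1)[of "s + e"] lap_V_pos[of "s + e"] s
        by (auto simp: exponential_density_def indicator_def ennreal_mult[symmetric] mult.assoc)
    qed
  qed
  also have "\<dots> = ennreal (LBINT e. indicator {0<..} e *\<^sub>R ?f e)"
    using i N unfolding set_integrable_def by (intro nn_integral_eq_integral) (auto simp: indicator_def)
  finally show ?thesis using e by (simp add: set_lebesgue_integral_def)
qed

end

section \<open>Independent marks\<close>

lemma emeasure_atom_measure:
  assumes "A \<in> sets borel"
  shows "emeasure (atom_measure w p) A = (\<Sum>i. ennreal (w i) * indicator A (p i))"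
proof -
  have "emeasure (atom_measure w p) A = (\<integral>\<^sup>+i. ennreal (w i) * indicator (p -` A) i \<partial>count_space UNIV)"
    unfolding atom_measure_def using assms by (subst emeasure_distr) (auto simp: emeasure_density)
  then show ?thesis by (simp add: nn_integral_count_space_nat indicator_def)
qed

lemma measure_atom_measure:
  assumes A: "A \<in> sets borel" and w: "\<And>i. 0 \<le> w i" and s: "summable w"
  shows "emeasure (atom_measure w p) A < \<infinity>"
    and "summable (\<lambda>i. w i * indicator A (p i))"
    and "measure (atom_measure w p) A = (\<Sum>i. w i * indicator A (p i))"
proof -
  show s': "summable (\<lambda>i. w i * indicator A (p i))"
    by (rule summable_comparison_test'[OF s, of 0]) (use w in \<open>auto simp: indicator_def\<close>)
  have "emeasure (atom_measure w p) A = (\<Sum>i. ennreal (w i * indicator A (p i)))"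
    unfolding emeasure_atom_measure[OF A]
    by (intro suminf_cong) (auto simp: indicator_def)
  also have "\<dots> = ennreal (\<Sum>i. w i * indicator A (p i))"
    by (intro suminf_ennreal2 s') (use w in auto)
  finally have e: "emeasure (atom_measure w p) A = ennreal (\<Sum>i. w i * indicator A (p i))" .
  show "emeasure (atom_measure w p) A < \<infinity>" unfolding e by simp
  show "measure (atom_measure w p) A = (\<Sum>i. w i * indicator A (p i))"
    unfolding measure_def e using w by (intro enn2real_ennreal suminf_nonneg s') auto
qed

locale marked_arrivals = prob_space M for M :: "'a measure" +
  fixes B0 :: "real measure" and c \<gamma> :: real and \<omega> E :: "nat \<Rightarrow> 'a \<Rightarrow> real"
  assumes g: "0 < \<gamma>" and c: "0 < c"
    and indep: "indep_vars (\<lambda>_. borel) (\<lambda>k. case k of Inl i \<Rightarrow> \<omega> i | Inr i \<Rightarrow> E i) (UNIV :: (nat + nat) set)"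
    and distr_\<omega>: "\<And>i. distr M borel (\<omega> i) = scale_measure (ennreal (1 / \<gamma>)) B0"
    and expo: "\<And>i. distributed M lborel (E i) (\<lambda>t. ennreal (exponential_density 1 t))"
begin

abbreviation "X \<equiv> (\<lambda>k. case k of Inl i \<Rightarrow> \<omega> i | Inr i \<Rightarrow> E i)"

lemma X_measurable: "X k \<in> borel_measurable M"
  using indep unfolding indep_vars_def by blast

lemma \<omega>_measurable [measurable]: "\<omega> i \<in> borel_measurable M"
  using X_measurable[of "Inl i"] by simp

lemma indep_E: "indep_vars (\<lambda>_. borel) E UNIV"
proof -
  have "indep_vars (\<lambda>j. Pi\<^sub>M {Inr j} (\<lambda>_. borel)) (\<lambda>j x. restrict (\<lambda>k. X k x) {Inr j}) (UNIV :: nat set)"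
    by (rule indep_vars_restrict[OF indep]) (auto simp: disjoint_family_on_def)
  then have "indep_vars (\<lambda>_. borel) (\<lambda>j x. (\<lambda>z. z (Inr j)) (restrict (\<lambda>k. X k x) {Inr j})) (UNIV :: nat set)"
    by (rule indep_vars_compose2) (auto intro!: measurable_component_singleton)
  then show ?thesis by simp
qed

sublocale exp_arrivals M E
  by unfold_locales (fact indep_E expo)+

lemma distr_E: "distr M borel (E i) = density lborel (\<lambda>t. ennreal (exponential_density 1 t))"
proof -
  have "distr M borel (E i) = distr M lborel (E i)" by (intro distr_cong) auto
  then show ?thesis using distributed_distr_eq_density[OF expo] by simp
qed

lemma AE_arrival_times: "AE x in M. arrival_times (\<lambda>i. Gam E i x) c \<gamma>"
  by (rule Gam_arrival_times[OF c g])

definition past :: "nat \<Rightarrow> (nat + nat) set" where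
  "past n = Inl ` {..<n} \<union> Inr ` {..<n}"

text \<open>This plays the part of conditioning on the past: the past is independent of the next
  waiting time and mark, and these two of each other, so Fubini applies twice.\<close>

lemma nn_integral_step:
  assumes Y: "Y \<in> measurable (Pi\<^sub>M (past n) (\<lambda>_. borel)) N"
    and f: "f \<in> borel_measurable (N \<Otimes>\<^sub>M (borel \<Otimes>\<^sub>M borel))"
  shows "(\<integral>\<^sup>+x. f (Y (restrict (\<lambda>k. X k x) (past n)), E n x, \<omega> n x) \<partial>M) =
    (\<integral>\<^sup>+x. (\<integral>\<^sup>+e. (\<integral>\<^sup>+w. f (Y (restrict (\<lambda>k. X k x) (past n)), e, w)
      \<partial>distr M borel (\<omega> n)) \<partial>distr M borel (E n)) \<partial>M)"
proof -
  let ?P = "\<lambda>x. restrict (\<lambda>k. X k x) (past n)"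
  let ?R = "\<lambda>x. restrict (\<lambda>k. X k x) {Inr n, Inl n}"
  let ?P1 = "Pi\<^sub>M (past n) (\<lambda>_. borel) :: (nat + nat \<Rightarrow> real) measure"
  let ?P2 = "Pi\<^sub>M {Inr n, Inl n} (\<lambda>_. borel) :: (nat + nat \<Rightarrow> real) measure"
  have [measurable]: "Y \<in> measurable ?P1 N" and [measurable]: "f \<in> borel_measurable (N \<Otimes>\<^sub>M (borel \<Otimes>\<^sub>M borel))"
    by fact+
  have [measurable]: "(\<lambda>z. z (Inr n)) \<in> measurable ?P2 borel" "(\<lambda>z. z (Inl n)) \<in> measurable ?P2 borel"
    by (auto intro!: measurable_component_singleton)
  have i1: "indep_var ?P1 ?P ?P2 ?R"
    by (rule indep_var_restrict[OF indep]) (auto simp: past_def)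
  have "indep_var (Pi\<^sub>M {Inr n} (\<lambda>_. borel)) (\<lambda>x. restrict (\<lambda>k. X k x) {Inr n})
      (Pi\<^sub>M {Inl n} (\<lambda>_. borel)) (\<lambda>x. restrict (\<lambda>k. X k x) {Inl n})"
    by (rule indep_var_restrict[OF indep]) auto
  then have "indep_var borel ((\<lambda>z. z (Inr n)) \<circ> (\<lambda>x. restrict (\<lambda>k. X k x) {Inr n}))
      borel ((\<lambda>z. z (Inl n)) \<circ> (\<lambda>x. restrict (\<lambda>k. X k x) {Inl n}))"
    by (rule indep_var_compose) (auto intro!: measurable_component_singleton)
  then have i2: "indep_var borel (E n) borel (\<omega> n)"
    by (simp add: comp_def)
  note d1 = indep_var_distribution_eq[THEN iffD1, OF i1] and d2 = indep_var_distribution_eq[THEN iffD1, OF i2]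
  have [measurable]: "?P \<in> measurable M ?P1" "?R \<in> measurable M ?P2" using d1 by simp_all
  have YP: "(\<lambda>x. Y (?P x)) \<in> measurable M N" by measurable
  interpret W: prob_space "distr M borel (\<omega> n)" by (rule prob_space_distr) simp
  interpret R: prob_space "distr M ?P2 ?R" by (rule prob_space_distr) measurable
  let ?F = "\<lambda>(y, z). f (Y y, z (Inr n), z (Inl n))"
  have F: "?F \<in> borel_measurable (?P1 \<Otimes>\<^sub>M ?P2)" by measurable
  have sets1: "sets (distr M ?P1 ?P \<Otimes>\<^sub>M distr M ?P2 ?R) = sets (?P1 \<Otimes>\<^sub>M ?P2)"
    by (intro sets_pair_measure_cong) simp_all
  have sets2: "sets (distr M borel (E n) \<Otimes>\<^sub>M distr M borel (\<omega> n)) = sets (borel \<Otimes>\<^sub>M borel)"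
    by (intro sets_pair_measure_cong) simp_all
  have "(\<integral>\<^sup>+x. f (Y (?P x), E n x, \<omega> n x) \<partial>M) =
      (\<integral>\<^sup>+z. ?F z \<partial>distr M (?P1 \<Otimes>\<^sub>M ?P2) (\<lambda>x. (?P x, ?R x)))"
    by (subst nn_integral_distr) (use F in auto)
  also have "\<dots> = (\<integral>\<^sup>+z. ?F z \<partial>(distr M ?P1 ?P \<Otimes>\<^sub>M distr M ?P2 ?R))"
    using d1 by simp
  also have "\<dots> = (\<integral>\<^sup>+y. \<integral>\<^sup>+z. ?F (y, z) \<partial>distr M ?P2 ?R \<partial>distr M ?P1 ?P)"
    by (rule R.nn_integral_fst[symmetric]) (use F in \<open>simp add: measurable_cong_sets[OF sets1 refl]\<close>)
  also have "\<dots> = (\<integral>\<^sup>+x. \<integral>\<^sup>+z. ?F (?P x, z) \<partial>distr M ?P2 ?R \<partial>M)"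
  proof (rule nn_integral_distr)
    have "?F \<in> borel_measurable (?P1 \<Otimes>\<^sub>M distr M ?P2 ?R)"
      using F by (simp add: measurable_cong_sets[OF sets_pair_measure_cong[OF refl sets_distr] refl])
    then have "(\<lambda>y. \<integral>\<^sup>+z. ?F (y, z) \<partial>distr M ?P2 ?R) \<in> borel_measurable ?P1"
      by (rule R.borel_measurable_nn_integral_fst)
    then show "(\<lambda>y. \<integral>\<^sup>+z. ?F (y, z) \<partial>distr M ?P2 ?R) \<in> borel_measurable (distr M ?P1 ?P)"
      by simp
  qed measurable
  also have "\<dots> = (\<integral>\<^sup>+x. (\<integral>\<^sup>+e. (\<integral>\<^sup>+w. f (Y (?P x), e, w) \<partial>distr M borel (\<omega> n)) \<partial>distr M borel (E n)) \<partial>M)"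
  \<comment> \<open>With the past frozen, the inner integral is carried back to M, where
    independence of E n and \<omega> n splits it again.\<close>
  proof (rule nn_integral_cong)
    fix x assume "x \<in> space M"
    then have Yx: "Y (?P x) \<in> space N" using measurable_space[OF YP] by simp
    have G [measurable]: "(\<lambda>z. f (Y (?P x), z)) \<in> borel_measurable (borel \<Otimes>\<^sub>M borel)"
      by (intro measurable_compose[OF _ f] measurable_Pair) (use Yx in simp_all)
    have "(\<lambda>z. f (Y (?P x), z (Inr n), z (Inl n))) \<in> borel_measurable ?P2"
      by (rule measurable_compose[OF _ G, of "\<lambda>z. (z (Inr n), z (Inl n))" ?P2]) measurable
    then have "(\<integral>\<^sup>+z. ?F (?P x, z) \<partial>distr M ?P2 ?R) = (\<integral>\<^sup>+x'. f (Y (?P x), E n x', \<omega> n x') \<partial>M)"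
      by (subst nn_integral_distr) auto
    also have "\<dots> = (\<integral>\<^sup>+z. f (Y (?P x), z) \<partial>distr M (borel \<Otimes>\<^sub>M borel) (\<lambda>x. (E n x, \<omega> n x)))"
      by (subst nn_integral_distr) auto
    also have "\<dots> = (\<integral>\<^sup>+z. f (Y (?P x), z) \<partial>(distr M borel (E n) \<Otimes>\<^sub>M distr M borel (\<omega> n)))"
      using d2 by simp
    also have "\<dots> = (\<integral>\<^sup>+e. (\<integral>\<^sup>+w. f (Y (?P x), e, w) \<partial>distr M borel (\<omega> n)) \<partial>distr M borel (E n))"
      by (intro W.nn_integral_fst[symmetric]) (use G in \<open>simp add: measurable_cong_sets[OF sets2 refl]\<close>)
    finally show "(\<integral>\<^sup>+z. ?F (?P x, z) \<partial>distr M ?P2 ?R) =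
        (\<integral>\<^sup>+e. (\<integral>\<^sup>+w. f (Y (?P x), e, w) \<partial>distr M borel (\<omega> n)) \<partial>distr M borel (E n))" .
  qed
  finally show ?thesis .
qed

end

section \<open>The joint Laplace transform\<close>

lemma measure_scale_measure:
  assumes "0 \<le> r"
  shows "measure (scale_measure (ennreal r) N) A = r * measure N A"
  using assms by (simp add: measure_def enn2real_mult)

text \<open>At most one indicator is nonzero at w, so the exponential of the sum becomes affine in
  the indicators and can be integrated over the mark term by term.\<close>

lemma exp_simple_sum_disjoint:
  fixes t :: "'i \<Rightarrow> real"
  assumes "finite I" "disjoint_family_on A I"
  shows "exp (- (\<Sum>j\<in>I. t j * indicator (A j) w) * y) =
    1 - (\<Sum>j\<in>I. indicator (A j) w * (1 - exp (- t j * y)))"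
proof (cases "\<exists>i\<in>I. w \<in> A i")
  case True
  then obtain i where i: "i \<in> I" "w \<in> A i" by auto
  have d: "indicator (A j) w = (if j = i then 1 else 0 :: real)" if "j \<in> I" for j
    using i assms(2) that by (auto simp: disjoint_family_on_def indicator_def)
  have "(\<Sum>j\<in>I. t j * indicator (A j) w) = (\<Sum>j\<in>I. if j = i then t j else 0)"
    by (intro sum.cong) (auto simp: d)
  moreover have "(\<Sum>j\<in>I. indicator (A j) w * (1 - exp (- t j * y))) = (\<Sum>j\<in>I. if j = i then 1 - exp (- t j * y) else 0)"
    by (intro sum.cong) (auto simp: d)
  ultimately show ?thesis using i assms(1) by simp
next
  case False
  then have "(\<Sum>j\<in>I. t j * indicator (A j) w) = 0" "(\<Sum>j\<in>I. indicator (A j) w * (1 - exp (- t j * y))) = 0"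
    by (auto intro!: sum.neutral)
  then show ?thesis by simp
qed

context marked_arrivals
begin

definition B :: "'a \<Rightarrow> real measure" where
  "B x = atom_measure (w_lim c \<gamma> (\<lambda>i. Gam E i x)) (\<lambda>i. \<omega> i x)"

lemma prob_mark:
  assumes "A \<in> sets borel"
  shows "measure (distr M borel (\<omega> n)) A = measure B0 A / \<gamma>"
  unfolding distr_\<omega> using g by (subst measure_scale_measure) auto

text \<open>The series for \<open>emeasure\<close> holds at every x, including those where it
  diverges, so no exceptional null set enters.\<close>

lemma measure_B_measurable [measurable]:
  assumes [measurable]: "A \<in> sets borel"
  shows "(\<lambda>x. measure (B x) A) \<in> borel_measurable M"
proof -
  note [measurable] = mu_inv_measurable[OF c g]
  show ?thesis
    unfolding measure_def B_def emeasure_atom_measure[OF assms] w_lim_def by measurable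
qed

lemma measure_B:
  assumes "A \<in> sets borel" "arrival_times (\<lambda>i. Gam E i x) c \<gamma>"
  shows "emeasure (B x) A < \<infinity>"
    and "summable (\<lambda>i. w_lim c \<gamma> (\<lambda>i. Gam E i x) i * indicator A (\<omega> i x))"
    and "measure (B x) A = (\<Sum>i. w_lim c \<gamma> (\<lambda>i. Gam E i x) i * indicator A (\<omega> i x))"
proof -
  interpret arrival_times "\<lambda>i. Gam E i x" c \<gamma> by fact
  have nn: "0 \<le> w_lim c \<gamma> (\<lambda>i. Gam E i x) i" for i using w_lim_range(1)[of i] by simp
  show "emeasure (B x) A < \<infinity>"
    and "summable (\<lambda>i. w_lim c \<gamma> (\<lambda>i. Gam E i x) i * indicator A (\<omega> i x))"
    and "measure (B x) A = (\<Sum>i. w_lim c \<gamma> (\<lambda>i. Gam E i x) i * indicator A (\<omega> i x))"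
    unfolding B_def using measure_atom_measure[OF assms(1) nn summable_w_lim] by auto
qed

text \<open>These are the side conditions of the fixed point equation: nonnegative current time, the
  empty sum at n = 0 included, and a strictly positive next waiting time.\<close>

lemma AE_increment:
  "AE x in M. 0 < E n x \<and> 0 \<le> (\<Sum>j<n. E j x)"
  using AE_arrival_times
proof eventually_elim
  case (elim x)
  interpret arrival_times "\<lambda>i. Gam E i x" c \<gamma> by fact
  have S: "(\<Sum>j<Suc k. E j x) = Gam E k x" for k by (simp add: Gam_def lessThan_Suc_atMost)
  show ?case
  proof (cases n)
    case 0
    then show ?thesis using G_pos[of 0] by (simp add: Gam_def)
  next
    case (Suc k)
    have "Gam E k x < Gam E (Suc k) x" using G_mono by (simp add: strict_mono_def)
    then show ?thesis using G_pos[of k] S[of k] Suc by (simp add: Gam_def)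
  qed
qed

context
  fixes I :: "'i set" and t :: "'i \<Rightarrow> real" and A :: "'i \<Rightarrow> real set"
  assumes I: "finite I" and disj: "disjoint_family_on A I"
    and A: "\<And>j. j \<in> I \<Longrightarrow> A j \<in> sets borel" and t: "\<And>j. j \<in> I \<Longrightarrow> 0 \<le> t j"
begin

definition "p j = measure B0 (A j) / \<gamma>"

definition "\<tau> w = (\<Sum>j\<in>I. t j * indicator (A j) w)"

abbreviation "V \<equiv> lap_V c \<gamma> I p t"

abbreviation "h \<equiv> lap_h c \<gamma> I p t"

lemma tau_measurable [measurable]: "\<tau> \<in> borel_measurable borel"
  unfolding \<tau>_def[abs_def] using A by measurable

lemma tau_nonneg: "0 \<le> \<tau> w"
  unfolding \<tau>_def using t by (intro sum_nonneg) auto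

lemma p_nonneg: "j \<in> I \<Longrightarrow> 0 \<le> p j"
  using g by (simp add: p_def)

lemma sum_p: "(\<Sum>j\<in>I. p j) \<le> 1"
proof -
  interpret W: prob_space "distr M borel (\<omega> 0)" by (rule prob_space_distr) simp
  have "(\<Sum>j\<in>I. p j) = (\<Sum>j\<in>I. measure (distr M borel (\<omega> 0)) (A j))"
    by (intro sum.cong) (auto simp: p_def prob_mark A)
  also have "\<dots> = measure (distr M borel (\<omega> 0)) (\<Union>j\<in>I. A j)"
    using I disj A by (intro W.finite_measure_finite_Union[symmetric]) auto
  finally show ?thesis by simp
qed

lemma V_meas [measurable]: "V \<in> borel_measurable borel"
  by (rule lap_V_measurable[OF c g p_nonneg sum_p t])

lemma V_pos: "0 < V s"
  by (rule lap_V_pos[OF c g p_nonneg sum_p t])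

lemma V_le_1: "V s \<le> 1"
  by (rule lap_V_le_1[OF c g p_nonneg sum_p t])

lemma V_at_top: "(V \<longlongrightarrow> 1) at_top"
  by (rule lap_V_at_top[OF c g p_nonneg sum_p t])

lemma mark_integral:
  assumes "0 < r"
  shows "(\<integral>\<^sup>+w. ennreal (exp (- \<tau> w * mu_inv c \<gamma> r)) \<partial>distr M borel (\<omega> n)) = ennreal (h r)"
proof -
  interpret W: prob_space "distr M borel (\<omega> n)" by (rule prob_space_distr) simp
  let ?y = "mu_inv c \<gamma> r"
  have e: "exp (- \<tau> w * ?y) = 1 - (\<Sum>j\<in>I. indicator (A j) w * (1 - exp (- t j * ?y)))" for w
    unfolding \<tau>_def by (rule exp_simple_sum_disjoint[OF I disj])
  have i: "integrable (distr M borel (\<omega> n)) (\<lambda>w. indicator (A j) w * (1 - exp (- t j * ?y)))" if "j \<in> I" for j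
    using A[OF that] by (intro integrable_mult_left) (auto simp: less_top[symmetric])
  have "integrable (distr M borel (\<omega> n)) (\<lambda>w. exp (- \<tau> w * ?y))"
    unfolding e by (intro Bochner_Integration.integrable_diff Bochner_Integration.integrable_sum i) auto
  then have "(\<integral>\<^sup>+w. ennreal (exp (- \<tau> w * ?y)) \<partial>distr M borel (\<omega> n)) =
      ennreal (\<integral>w. exp (- \<tau> w * ?y) \<partial>distr M borel (\<omega> n))"
    by (rule nn_integral_eq_integral) auto
  also have "(\<integral>w. exp (- \<tau> w * ?y) \<partial>distr M borel (\<omega> n)) =
      (\<integral>w. 1 \<partial>distr M borel (\<omega> n)) - (\<integral>w. (\<Sum>j\<in>I. indicator (A j) w * (1 - exp (- t j * ?y))) \<partial>distr M borel (\<omega> n))"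
    unfolding e by (rule Bochner_Integration.integral_diff)
      (simp, rule Bochner_Integration.integrable_sum, rule i)
  also have "(\<integral>w. (\<Sum>j\<in>I. indicator (A j) w * (1 - exp (- t j * ?y))) \<partial>distr M borel (\<omega> n)) =
      (\<Sum>j\<in>I. \<integral>w. indicator (A j) w * (1 - exp (- t j * ?y)) \<partial>distr M borel (\<omega> n))"
    by (rule Bochner_Integration.integral_sum) (rule i)
  also have "(\<integral>w. 1 \<partial>distr M borel (\<omega> n)) -
      (\<Sum>j\<in>I. \<integral>w. indicator (A j) w * (1 - exp (- t j * ?y)) \<partial>distr M borel (\<omega> n)) =
      1 - (\<Sum>j\<in>I. p j * (1 - exp (- t j * ?y)))"
  proof (intro arg_cong2[where f="(-)"] sum.cong refl)
    show "(\<integral>w. 1 \<partial>distr M borel (\<omega> n)) = (1 :: real)" using W.prob_space by simp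
    show "(\<integral>w. indicator (A j) w * (1 - exp (- t j * ?y)) \<partial>distr M borel (\<omega> n)) = p j * (1 - exp (- t j * ?y))"
      if "j \<in> I" for j
      using prob_mark[OF A[OF that], of n] by (simp add: p_def)
  qed
  finally show ?thesis unfolding lap_h_def .
qed

definition Q :: "nat \<Rightarrow> 'a \<Rightarrow> real" where
  "Q n x = (\<Prod>i<n. exp (- \<tau> (\<omega> i x) * mu_inv c \<gamma> (Gam E i x)))"

text \<open>Unlike \<open>Gam\<close>, this has the value 0 at n = 0, which lets the induction on n
  start from Q = 1 and V 0.\<close>

definition S :: "nat \<Rightarrow> 'a \<Rightarrow> real" where
  "S n x = (\<Sum>j<n. E j x)"

lemma Gam_eq_S: "Gam E n x = S (Suc n) x"
  by (simp add: Gam_def S_def lessThan_Suc_atMost)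

lemma S_meas [measurable]: "S n \<in> borel_measurable M"
  unfolding S_def[abs_def] by measurable

lemma Q_meas [measurable]: "Q n \<in> borel_measurable M"
proof -
  note [measurable] = mu_inv_measurable[OF c g]
  show ?thesis unfolding Q_def[abs_def] by measurable
qed

lemma Q_nonneg: "0 \<le> Q n x"
  unfolding Q_def by (intro prod_nonneg) auto

text \<open>Conditionally on the first \<open>n\<close> marked arrivals, integrating out the next mark turns the factor
  \<open>exp (- \<tau> w * mu_inv r)\<close> into \<open>h r\<close>, and integrating out the next waiting time is the fixed
  point equation for \<open>V\<close>.\<close>

lemma martingale_step:
  "(\<integral>\<^sup>+x. ennreal (Q (Suc n) x * V (S (Suc n) x)) \<partial>M) = (\<integral>\<^sup>+x. ennreal (Q n x * V (S n x)) \<partial>M)"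
proof -
  note [measurable] = mu_inv_measurable[OF c g]
  let ?P = "\<lambda>x. restrict (\<lambda>k. X k x) (past n)"
  let ?PB = "Pi\<^sub>M (past n) (\<lambda>_. borel) :: (nat + nat \<Rightarrow> real) measure"
  \<comment> \<open>Y compresses the past into the pair of Q n and S n; f combines this pair with
    the next waiting time and the next mark.\<close>
  define Y where "Y y = ((\<Prod>i<n. exp (- \<tau> (y (Inl i)) * mu_inv c \<gamma> (\<Sum>j\<le>i. y (Inr j)))), (\<Sum>j<n. y (Inr j)))"
    for y :: "nat + nat \<Rightarrow> real"
  define f where "f = (\<lambda>z :: (real \<times> real) \<times> (real \<times> real).
    ennreal (fst (fst z)) * ennreal (exp (- \<tau> (snd (snd z)) * mu_inv c \<gamma> (snd (fst z) + fst (snd z))) *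
      V (snd (fst z) + fst (snd z))))"
  have c1: "(\<lambda>y. y (Inl i)) \<in> borel_measurable ?PB" if "i < n" for i
    by (rule measurable_component_singleton) (use that in \<open>auto simp: past_def\<close>)
  have c2: "(\<lambda>y. y (Inr i)) \<in> borel_measurable ?PB" if "i < n" for i
    by (rule measurable_component_singleton) (use that in \<open>auto simp: past_def\<close>)
  have Ym: "Y \<in> measurable ?PB (borel \<Otimes>\<^sub>M borel)"
    unfolding Y_def[abs_def]
  proof (intro measurable_Pair borel_measurable_prod borel_measurable_sum)
    fix i assume "i \<in> {..<n}"
    have [measurable]: "(\<lambda>y. \<Sum>j\<le>i. y (Inr j)) \<in> borel_measurable ?PB"
      by (intro borel_measurable_sum c2) (use \<open>i \<in> {..<n}\<close> in auto)
    have [measurable]: "(\<lambda>y. y (Inl i)) \<in> borel_measurable ?PB"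
      using c1[of i] \<open>i \<in> {..<n}\<close> by simp
    show "(\<lambda>y. exp (- \<tau> (y (Inl i)) * mu_inv c \<gamma> (\<Sum>j\<le>i. y (Inr j)))) \<in> borel_measurable ?PB"
      by measurable
  qed (use c2 in auto)
  have fm: "f \<in> borel_measurable ((borel \<Otimes>\<^sub>M borel) \<Otimes>\<^sub>M (borel \<Otimes>\<^sub>M borel))"
    unfolding f_def by measurable
  have YP: "Y (?P x) = (Q n x, S n x)" for x
    unfolding Y_def Q_def S_def Gam_def by (auto simp: past_def intro!: prod.cong sum.cong)
  have "ennreal (Q (Suc n) x * V (S (Suc n) x)) = f (Y (?P x), E n x, \<omega> n x)" for x
  proof -
    have "S (Suc n) x = S n x + E n x" "Q (Suc n) x = Q n x * exp (- \<tau> (\<omega> n x) * mu_inv c \<gamma> (S n x + E n x))"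
      unfolding Q_def Gam_eq_S by (simp_all add: S_def)
    then show ?thesis unfolding YP f_def using Q_nonneg[of n x] V_pos[of "S n x + E n x"]
      by (simp add: ennreal_mult[symmetric] mult.assoc)
  qed
  then have "(\<integral>\<^sup>+x. ennreal (Q (Suc n) x * V (S (Suc n) x)) \<partial>M) =
    (\<integral>\<^sup>+x. (\<integral>\<^sup>+e. (\<integral>\<^sup>+w. f (Y (?P x), e, w) \<partial>distr M borel (\<omega> n)) \<partial>distr M borel (E n)) \<partial>M)"
    using nn_integral_step[OF Ym fm] by simp
  also have "\<dots> = (\<integral>\<^sup>+x. ennreal (Q n x * V (S n x)) \<partial>M)"
  proof (rule nn_integral_cong_AE)
    have pos: "AE e in distr M borel (E n). 0 < e"
      using AE_increment[of n] by (subst AE_distr_iff) auto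
    show "AE x in M. (\<integral>\<^sup>+e. (\<integral>\<^sup>+w. f (Y (?P x), e, w) \<partial>distr M borel (\<omega> n)) \<partial>distr M borel (E n)) =
        ennreal (Q n x * V (S n x))"
      using AE_increment[of n]
    proof eventually_elim
      case (elim x)
      then have s: "0 \<le> S n x" by (simp add: S_def)
      have "(\<integral>\<^sup>+e. (\<integral>\<^sup>+w. f (Y (?P x), e, w) \<partial>distr M borel (\<omega> n)) \<partial>distr M borel (E n)) =
          (\<integral>\<^sup>+e. ennreal (Q n x) * ennreal (h (S n x + e) * V (S n x + e)) \<partial>distr M borel (E n))"
      proof (rule nn_integral_cong_AE)
        show "AE e in distr M borel (E n). (\<integral>\<^sup>+w. f (Y (?P x), e, w) \<partial>distr M borel (\<omega> n)) =
            ennreal (Q n x) * ennreal (h (S n x + e) * V (S n x + e))"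
          using pos
        proof eventually_elim
          case (elim e)
          then have se: "0 < S n x + e" using s by simp
          have "f (Y (?P x), e, w) = ennreal (Q n x) * ennreal (V (S n x + e)) * ennreal (exp (- \<tau> w * mu_inv c \<gamma> (S n x + e)))" for w
            unfolding YP f_def using V_pos[of "S n x + e"]
            by (simp add: ennreal_mult mult_ac)
          then have "(\<integral>\<^sup>+w. f (Y (?P x), e, w) \<partial>distr M borel (\<omega> n)) =
              ennreal (Q n x) * ennreal (V (S n x + e)) * ennreal (h (S n x + e))"
            using mark_integral[OF se, of n] by (simp add: nn_integral_cmult)
          then show ?case
            using V_pos[of "S n x + e"] lap_h_range(1)[OF c g p_nonneg sum_p t se]
            by (simp add: ennreal_mult mult_ac)
        qed
      qed
      also have "\<dots> = ennreal (Q n x) * (\<integral>\<^sup>+e. ennreal (h (S n x + e) * V (S n x + e)) \<partial>distr M borel (E n))"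
        by (rule nn_integral_cmult) (simp add: lap_h_def[abs_def])
      also have "(\<integral>\<^sup>+e. ennreal (h (S n x + e) * V (S n x + e)) \<partial>distr M borel (E n)) = ennreal (V (S n x))"
        unfolding distr_E by (rule lap_V_eq_integral[OF c g p_nonneg sum_p t s])
      also have "ennreal (Q n x) * ennreal (V (S n x)) = ennreal (Q n x * V (S n x))"
        using Q_nonneg[of n x] V_pos[of "S n x"] by (simp add: ennreal_mult)
      finally show ?case .
    qed
  qed
  finally show ?thesis .
qed

lemma martingale_expectation: "expectation (\<lambda>x. Q n x * V (S n x)) = V 0"
proof -
  have "(\<integral>\<^sup>+x. ennreal (Q n x * V (S n x)) \<partial>M) = ennreal (V 0)"
    by (induction n) (simp_all add: martingale_step, simp add: Q_def S_def emeasure_space_1)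
  then show ?thesis
    using Q_nonneg V_pos
    by (subst integral_eq_nn_integral) (auto intro!: mult_nonneg_nonneg simp: less_imp_le)
qed

lemma laplace_series:
  "expectation (\<lambda>x. exp (- (\<Sum>i. \<tau> (\<omega> i x) * mu_inv c \<gamma> (Gam E i x)))) = V 0"
proof -
  note [measurable] = mu_inv_measurable[OF c g]
  have "(\<lambda>n. expectation (\<lambda>x. Q n x * V (S n x))) \<longlonglongrightarrow>
      expectation (\<lambda>x. exp (- (\<Sum>i. \<tau> (\<omega> i x) * mu_inv c \<gamma> (Gam E i x))))"
  proof (rule integral_dominated_convergence[where w="\<lambda>_. 1"])
    show "AE x in M. (\<lambda>n. Q n x * V (S n x)) \<longlonglongrightarrow> exp (- (\<Sum>i. \<tau> (\<omega> i x) * mu_inv c \<gamma> (Gam E i x)))"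
      using AE_arrival_times
    proof eventually_elim
      case (elim x)
      interpret arrival_times "\<lambda>i. Gam E i x" c \<gamma> by fact
      have "\<tau> w \<le> (\<Sum>j\<in>I. t j)" for w
        unfolding \<tau>_def using t by (intro sum_mono) (auto simp: indicator_def)
      then have "summable (\<lambda>i. \<tau> (\<omega> i x) * mu_inv c \<gamma> (Gam E i x))"
        using tau_nonneg w_lim_range
        by (intro summable_comparison_test'[OF summable_mult[OF summable_w_lim, of "\<Sum>j\<in>I. t j"], of 0])
          (auto simp: w_lim_def abs_mult less_imp_le intro!: mult_right_mono)
      then have "(\<lambda>n. exp (- (\<Sum>i<n. \<tau> (\<omega> i x) * mu_inv c \<gamma> (Gam E i x)))) \<longlonglongrightarrow>
          exp (- (\<Sum>i. \<tau> (\<omega> i x) * mu_inv c \<gamma> (Gam E i x)))"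
        by (intro tendsto_intros summable_LIMSEQ)
      also have "(\<lambda>n. exp (- (\<Sum>i<n. \<tau> (\<omega> i x) * mu_inv c \<gamma> (Gam E i x)))) = (\<lambda>n. Q n x)"
        by (simp add: Q_def exp_sum[symmetric] sum_negf)
      finally have q: "(\<lambda>n. Q n x) \<longlonglongrightarrow> exp (- (\<Sum>i. \<tau> (\<omega> i x) * mu_inv c \<gamma> (Gam E i x)))" .
      \<comment> \<open>The law of large numbers drives the arrival times to infinity, where V tends
        to 1.\<close>
      have "filterlim (\<lambda>n. Gam E n x / real n * real n) at_top sequentially"
        by (rule filterlim_tendsto_pos_mult_at_top[OF G_lim]) (auto intro: filterlim_real_sequentially)
      moreover have "\<forall>\<^sub>F n in sequentially. Gam E n x / real n * real n = Gam E n x"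
        using eventually_gt_at_top[of 0] by eventually_elim simp
      ultimately have "filterlim (\<lambda>n. S (Suc n) x) at_top sequentially"
        unfolding Gam_eq_S[symmetric] by (simp add: filterlim_cong[OF refl refl])
      then have "(\<lambda>n. V (S (Suc n) x)) \<longlonglongrightarrow> 1"
        by (rule filterlim_compose[OF V_at_top])
      then have "(\<lambda>n. V (S n x)) \<longlonglongrightarrow> 1" by (rule LIMSEQ_imp_Suc)
      from tendsto_mult[OF q this] show ?case by simp
    qed
    show "AE x in M. norm (Q n x * V (S n x)) \<le> 1" for n
      using AE_arrival_times
    proof eventually_elim
      case (elim x)
      interpret arrival_times "\<lambda>i. Gam E i x" c \<gamma> by fact
      have "Q n x \<le> 1"
        unfolding Q_def using tau_nonneg w_lim_range(1)[unfolded w_lim_def]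
        by (intro prod_le_1) (auto simp: less_imp_le)
      then show ?case
        using Q_nonneg[of n x] V_pos[of "S n x"] V_le_1[of "S n x"]
        by (simp add: abs_mult mult_le_one)
    qed
  qed measurable
  then show ?thesis unfolding martingale_expectation by (simp add: LIMSEQ_const_iff)
qed

lemma joint_laplace:
  "expectation (\<lambda>x. exp (- (\<Sum>j\<in>I. t j * measure (B x) (A j)))) =
    exp (- (\<Sum>j\<in>I. measure B0 (A j) * levy_exponent c (t j)))"
proof -
  note [measurable] = mu_inv_measurable[OF c g]
  have "expectation (\<lambda>x. exp (- (\<Sum>j\<in>I. t j * measure (B x) (A j)))) =
      expectation (\<lambda>x. exp (- (\<Sum>i. \<tau> (\<omega> i x) * mu_inv c \<gamma> (Gam E i x))))"
  proof (rule integral_cong_AE)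
    show "AE x in M. exp (- (\<Sum>j\<in>I. t j * measure (B x) (A j))) =
        exp (- (\<Sum>i. \<tau> (\<omega> i x) * mu_inv c \<gamma> (Gam E i x)))"
      using AE_arrival_times
    proof eventually_elim
      case (elim x)
      note m = measure_B[OF A elim]
      have "(\<Sum>j\<in>I. t j * measure (B x) (A j)) =
          (\<Sum>j\<in>I. \<Sum>i. t j * (w_lim c \<gamma> (\<lambda>i. Gam E i x) i * indicator (A j) (\<omega> i x)))"
        using m by (intro sum.cong) (auto simp: suminf_mult)
      also have "\<dots> = (\<Sum>i. \<Sum>j\<in>I. t j * (w_lim c \<gamma> (\<lambda>i. Gam E i x) i * indicator (A j) (\<omega> i x)))"
        using m(2) by (intro suminf_sum[symmetric] summable_mult)
      also have "\<dots> = (\<Sum>i. \<tau> (\<omega> i x) * mu_inv c \<gamma> (Gam E i x))"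
        unfolding \<tau>_def w_lim_def sum_distrib_right by (intro suminf_cong sum.cong) (auto simp: mult_ac)
      finally show ?case by simp
    qed
  qed (use A in measurable)
  also have "\<dots> = exp (- (\<Sum>j\<in>I. measure B0 (A j) * levy_exponent c (t j)))"
    \<comment> \<open>V 0 is the case s \<le> 0 of \<open>lap_V\<close>, and \<gamma> * p j is the
      B0-measure of A j.\<close>
    unfolding laplace_series using g by (simp add: lap_V_def p_def)
  finally show ?thesis .
qed

end

end

section \<open>Independence from moments\<close>

context prob_space
begin

lemma integrable_bounded_mult:
  fixes U f :: "'a \<Rightarrow> real"
  assumes "integrable M U" "f \<in> borel_measurable M" "\<And>x. \<bar>f x\<bar> \<le> K"
  shows "integrable M (\<lambda>x. f x * U x)"
proof (rule Bochner_Integration.integrable_bound)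
  show "integrable M (\<lambda>x. K * U x)" using assms(1) by simp
  have "\<bar>f x\<bar> \<le> \<bar>K\<bar>" for x using assms(3)[of x] by linarith
  then show "AE x in M. norm (f x * U x) \<le> norm (K * U x)"
    by (intro AE_I2) (simp add: abs_mult mult_right_mono)
qed (use assms(1,2) in auto)

text \<open>\<open>U\<close> may change sign, so this is moment uniqueness for a signed measure on the unit interval.\<close>

lemma moments_zero_continuous:
  fixes X U :: "'a \<Rightarrow> real"
  assumes X [measurable]: "X \<in> borel_measurable M" and X01: "\<And>x. X x \<in> {0..1}"
    and U: "integrable M U" and mom: "\<And>m :: nat. expectation (\<lambda>x. X x ^ m * U x) = 0"
    and f: "continuous_on UNIV f"
  shows "expectation (\<lambda>x. f (X x) * U x) = 0"
proof -
  have fm [measurable]: "f \<in> borel_measurable borel" using f by (rule borel_measurable_continuous_onI)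
  have "bounded (f ` {0..1})"
    by (intro compact_imp_bounded compact_continuous_image continuous_on_subset[OF f]) auto
  then obtain K where K: "\<forall>y\<in>{0..1}. \<bar>f y\<bar> \<le> K" unfolding bounded_iff by auto
  have fU: "integrable M (\<lambda>x. f (X x) * U x)"
    by (rule integrable_bounded_mult[OF U, where K=K]) (use K X01 in auto)
  define L where "L = expectation (\<lambda>x. \<bar>U x\<bar>)"
  have L: "0 \<le> L" unfolding L_def by simp
  have "\<bar>expectation (\<lambda>x. f (X x) * U x)\<bar> \<le> e * L" if e: "0 < e" for e
  proof -
    obtain q where q: "real_polynomial_function q" "\<And>y. y \<in> {0..1} \<Longrightarrow> \<bar>f y - q y\<bar> < e"
      by (rule Stone_Weierstrass_real_polynomial_function[OF compact_Icc continuous_on_subset[OF f subset_UNIV] e])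
        blast
    then obtain a n where qe: "q = (\<lambda>y. \<Sum>i\<le>n. a i * y ^ i)"
      unfolding real_polynomial_function_iff_sum by blast
    have pU: "integrable M (\<lambda>x. X x ^ i * U x)" for i
      by (rule integrable_bounded_mult[OF U, where K=1])
        (use X01 in \<open>auto simp: power_abs intro!: power_le_one\<close>)
    have qU: "(\<lambda>x. q (X x) * U x) = (\<lambda>x. \<Sum>i\<le>n. a i * (X x ^ i * U x))"
      by (simp add: qe sum_distrib_right mult.assoc)
    have iq: "integrable M (\<lambda>x. q (X x) * U x)"
      unfolding qU by (intro Bochner_Integration.integrable_sum integrable_mult_right pU)
    have "expectation (\<lambda>x. q (X x) * U x) = 0"
      unfolding qU using pU mom by (simp add: Bochner_Integration.integral_sum)
    then have "expectation (\<lambda>x. f (X x) * U x) = expectation (\<lambda>x. f (X x) * U x - q (X x) * U x)"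
      using fU iq by simp
    also have "\<bar>\<dots>\<bar> \<le> expectation (\<lambda>x. e * \<bar>U x\<bar>)"
    proof (rule order_trans[OF integral_abs_bound integral_mono])
      show "\<bar>f (X x) * U x - q (X x) * U x\<bar> \<le> e * \<bar>U x\<bar>" for x
        using q(2)[OF X01[of x]]
        unfolding left_diff_distrib[symmetric] abs_mult by (intro mult_right_mono) auto
    qed (use fU iq U in auto)
    finally show ?thesis by (simp add: L_def)
  qed
  then have "\<bar>expectation (\<lambda>x. f (X x) * U x)\<bar> \<le> 0 + e" if "0 < e" for e
  proof -
    \<comment> \<open>Rescaling by L + 1 instead of L covers L = 0.\<close>
    have "e / (L + 1) * L \<le> e" using L that by (simp add: field_simps)
    moreover have "\<bar>expectation (\<lambda>x. f (X x) * U x)\<bar> \<le> e / (L + 1) * L"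
      by (rule \<open>\<And>e. 0 < e \<Longrightarrow> \<bar>expectation (\<lambda>x. f (X x) * U x)\<bar> \<le> e * L\<close>) (use L that in simp)
    ultimately show ?thesis by simp
  qed
  then have "\<bar>expectation (\<lambda>x. f (X x) * U x)\<bar> \<le> 0" by (rule field_le_epsilon)
  then show ?thesis by simp
qed

text \<open>The continuous steps from 1 at a to 0 at a + 1 / (k + 1) converge pointwise to the
  indicator, with \<bar>U\<bar> as integrable majorant.\<close>

lemma moments_zero_atMost:
  fixes X U :: "'a \<Rightarrow> real"
  assumes X [measurable]: "X \<in> borel_measurable M" and X01: "\<And>x. X x \<in> {0..1}"
    and U: "integrable M U" and mom: "\<And>m :: nat. expectation (\<lambda>x. X x ^ m * U x) = 0"
  shows "expectation (\<lambda>x. indicator {..a} (X x) * U x) = 0"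
proof -
  let ?b = "\<lambda>k :: nat. a + 1 / (real k + 1)"
  have c: "continuous_on UNIV (cts_step a (?b k))" for k
    by (intro uniformly_continuous_imp_continuous cts_step_uniformly_continuous) simp
  have [measurable]: "cts_step a (?b k) \<in> borel_measurable borel" for k
    by (rule borel_measurable_continuous_onI[OF c])
  have [measurable]: "U \<in> borel_measurable M" using U by simp
  have "(\<lambda>k. expectation (\<lambda>x. cts_step a (?b k) (X x) * U x)) \<longlonglongrightarrow>
      expectation (\<lambda>x. indicator {..a} (X x) * U x)"
  proof (rule integral_dominated_convergence[where w="\<lambda>x. \<bar>U x\<bar>"])
    have cs: "\<bar>cts_step a b y\<bar> \<le> 1" if "a < b" for b y
      using that by (auto simp: cts_step_def)
    show "AE x in M. norm (cts_step a (?b k) (X x) * U x) \<le> \<bar>U x\<bar>" for k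
      by (intro AE_I2) (use cs[of "?b k"] in \<open>simp add: abs_mult mult_left_le_one_le\<close>)
    show "AE x in M. (\<lambda>k. cts_step a (?b k) (X x) * U x) \<longlonglongrightarrow> indicator {..a} (X x) * U x"
    proof (intro AE_I2 tendsto_mult_right tendsto_eventually)
      fix x
      show "\<forall>\<^sub>F k in sequentially. cts_step a (?b k) (X x) = indicator {..a} (X x)"
      proof (cases "X x \<le> a")
        case True
        then show ?thesis by (simp add: cts_step_def)
      next
        case False
        have "(\<lambda>k. 1 / (real k + 1)) \<longlonglongrightarrow> 0"
          using LIMSEQ_ignore_initial_segment[OF lim_1_over_n, of 1] by (simp add: add.commute)
        then have "\<forall>\<^sub>F k in sequentially. 1 / (real k + 1) < X x - a"
          using False by (intro order_tendstoD) auto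
        then show ?thesis by eventually_elim (use False in \<open>simp add: cts_step_def\<close>)
      qed
    qed
  qed (use U in auto)
  moreover have "expectation (\<lambda>x. cts_step a (?b k) (X x) * U x) = 0" for k
    by (rule moments_zero_continuous[OF X X01 U mom c])
  ultimately show ?thesis by (simp add: LIMSEQ_const_iff)
qed

text \<open>Powers are exchanged for indicators of half-lines one coordinate at a time; once all are
  exchanged, the product formula holds on a generator of the Borel sets. The empty index set is
  split off because \<open>indep_vars_finite\<close> asks for a nonempty one.\<close>

lemma indep_vars_of_moments:
  fixes X :: "'i \<Rightarrow> 'a \<Rightarrow> real"
  assumes I: "finite I" and X: "\<And>j. j \<in> I \<Longrightarrow> X j \<in> borel_measurable M"
    and X01: "\<And>j x. X j x \<in> {0..1}"
    and mom: "\<And>m :: 'i \<Rightarrow> nat. expectation (\<lambda>x. \<Prod>j\<in>I. X j x ^ m j) = (\<Prod>j\<in>I. expectation (\<lambda>x. X j x ^ m j))"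
  shows "indep_vars (\<lambda>_. borel) X I"
proof (cases "I = {}")
  case True
  show ?thesis unfolding True indep_vars_def2 indep_sets_def by simp
next
  case False
  \<comment> \<open>The coordinates in J already carry indicators, the others still carry
    powers.\<close>
  define F where "F J a m j x = (if j \<in> J then indicator {..a j} (X j x) else X j x ^ m j)"
    for J a and m :: "'i \<Rightarrow> nat" and j x
  have Fm: "F J a m j \<in> borel_measurable M" if "j \<in> I" for J a m j
    unfolding F_def[abs_def] using X[OF that] by simp
  have F01: "\<bar>F J a m j x\<bar> \<le> 1" for J a m j x
    using X01[of j x] by (auto simp: F_def indicator_def power_abs intro!: power_le_one)
  have Fi: "integrable M (\<lambda>x. \<Prod>j\<in>K. F J a m j x)" if "K \<subseteq> I" for J a m K
  proof (rule integrable_const_bound[where B=1])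
    show "AE x in M. norm (\<Prod>j\<in>K. F J a m j x) \<le> 1"
      using F01 by (intro AE_I2) (auto simp: abs_prod intro!: prod_le_1)
    show "(\<lambda>x. \<Prod>j\<in>K. F J a m j x) \<in> borel_measurable M"
      using that Fm by (intro borel_measurable_prod) auto
  qed
  have fact: "expectation (\<lambda>x. \<Prod>j\<in>I. F J a m j x) = (\<Prod>j\<in>I. expectation (F J a m j))"
    if "finite J" "J \<subseteq> I" for J a m
    using that
  \<comment> \<open>The exponents are generalised because the induction hypothesis is used with an
    arbitrary exponent at the coordinate k.\<close>
  proof (induction J arbitrary: m rule: finite_induct)
    case empty
    then show ?case using mom[of m] by (simp add: F_def[abs_def])
  next
    case (insert k J)
    then have k: "k \<in> I" and kJ: "k \<notin> J" by auto
    let ?R = "I - {k}"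
    let ?C = "\<Prod>j\<in>?R. expectation (F J a m j)"
    \<comment> \<open>The induction hypothesis says that all moments of X k against U vanish; then
      so does the integral of the indicator of {..a k} against U.\<close>
    define U where "U x = (\<Prod>j\<in>?R. F J a m j x) - ?C" for x
    have Ui: "integrable M U" unfolding U_def[abs_def] using Fi[of ?R] by auto
    have bnd: "integrable M (\<lambda>x. f x * U x)" "integrable M f"
      "expectation (\<lambda>x. f x * U x) = expectation (\<lambda>x. f x * (\<Prod>j\<in>?R. F J a m j x)) - expectation f * ?C"
      if [measurable]: "f \<in> borel_measurable M" and "\<And>x. \<bar>f x\<bar> \<le> 1" for f :: "'a \<Rightarrow> real"
    proof -
      show "integrable M (\<lambda>x. f x * U x)" by (rule integrable_bounded_mult[OF Ui]) (use that in auto)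
      show fi: "integrable M f" by (rule integrable_const_bound[where B=1]) (use that in auto)
      have "integrable M (\<lambda>x. f x * (\<Prod>j\<in>?R. F J a m j x))"
        by (rule integrable_bounded_mult[OF Fi]) (use that in auto)
      with fi show "expectation (\<lambda>x. f x * U x) = expectation (\<lambda>x. f x * (\<Prod>j\<in>?R. F J a m j x)) - expectation f * ?C"
        unfolding U_def right_diff_distrib by simp
    qed
    have "expectation (\<lambda>x. X k x ^ n * U x) = 0" for n
    proof -
      have "expectation (\<lambda>x. X k x ^ n * (\<Prod>j\<in>?R. F J a m j x)) = expectation (\<lambda>x. \<Prod>j\<in>I. F J a (m(k := n)) j x)"
        unfolding prod.remove[OF I k]
        by (intro Bochner_Integration.integral_cong refl arg_cong2[where f="(*)"] prod.cong) (use kJ in \<open>auto simp: F_def\<close>)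
      also have "\<dots> = (\<Prod>j\<in>I. expectation (F J a (m(k := n)) j))" using insert by auto
      also have "\<dots> = expectation (\<lambda>x. X k x ^ n) * ?C"
        unfolding prod.remove[OF I k]
        by (intro arg_cong2[where f="(*)"] prod.cong refl Bochner_Integration.integral_cong) (use kJ in \<open>auto simp: F_def[abs_def]\<close>)
      finally show ?thesis
        using bnd(3)[of "\<lambda>x. X k x ^ n"] X[OF k] X01 by (auto simp: power_abs power_le_one)
    qed
    then have z: "expectation (\<lambda>x. indicator {..a k} (X k x) * U x) = 0"
      by (rule moments_zero_atMost[OF X[OF k] X01 Ui])
    have "expectation (\<lambda>x. \<Prod>j\<in>I. F (insert k J) a m j x) =
        expectation (\<lambda>x. indicator {..a k} (X k x) * (\<Prod>j\<in>?R. F J a m j x))"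
      unfolding prod.remove[OF I k]
      by (intro Bochner_Integration.integral_cong refl arg_cong2[where f="(*)"] prod.cong) (auto simp: F_def)
    also have "\<dots> = expectation (\<lambda>x. indicator {..a k} (X k x)) * ?C"
      using z bnd(3)[of "\<lambda>x. indicator {..a k} (X k x)"] X[OF k] by (auto simp: indicator_def)
    also have "\<dots> = (\<Prod>j\<in>I. expectation (F (insert k J) a m j))"
      unfolding prod.remove[OF I k]
      by (intro arg_cong2[where f="(*)"] prod.cong refl Bochner_Integration.integral_cong) (auto simp: F_def[abs_def])
    finally show ?case .
  qed
  have atMost: "prob (\<Inter>j\<in>I. X j -` {..a j} \<inter> space M) = (\<Prod>j\<in>I. prob (X j -` {..a j} \<inter> space M))" for a
  proof -
    have m: "X j -` {..a j} \<inter> space M \<in> events" if "j \<in> I" for j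
      using X[OF that] by measurable
    have "prob (\<Inter>j\<in>I. X j -` {..a j} \<inter> space M) = expectation (indicator (\<Inter>j\<in>I. X j -` {..a j} \<inter> space M))"
      using False by (subst Bochner_Integration.integral_indicator) (auto intro!: arg_cong[where f=prob])
    also have "\<dots> = expectation (\<lambda>x. \<Prod>j\<in>I. F I a (\<lambda>_. 0) j x)"
      using I by (intro Bochner_Integration.integral_cong) (auto simp: F_def indicator_def)
    also have "\<dots> = (\<Prod>j\<in>I. expectation (F I a (\<lambda>_. 0) j))" by (rule fact[OF I order_refl])
    also have "\<dots> = (\<Prod>j\<in>I. prob (X j -` {..a j} \<inter> space M))"
    proof (rule prod.cong[OF refl])
      fix j assume j: "j \<in> I"
      have "expectation (F I a (\<lambda>_. 0) j) = expectation (indicator (X j -` {..a j} \<inter> space M))"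
        using j by (intro Bochner_Integration.integral_cong) (auto simp: F_def indicator_def)
      then show "expectation (F I a (\<lambda>_. 0) j) = prob (X j -` {..a j} \<inter> space M)"
        using m[OF j] by simp
    qed
    finally show ?thesis .
  qed
  \<comment> \<open>The criterion \<open>indep_vars_finite\<close> wants the whole space among the
    generators, so \<open>UNIV\<close> joins the half-lines.\<close>
  let ?G = "insert UNIV (range (\<lambda>a::real. {..a}))"
  have sig: "sets borel = sigma_sets UNIV ?G"
  proof -
    have "sets (borel :: real measure) = sigma_sets UNIV (range (\<lambda>a::real. {..a}))"
      unfolding borel_eq_atMost by simp
    also have "\<dots> = sigma_sets UNIV ?G"
      by (rule sigma_sets_eqI) (auto intro: sigma_sets_top)
    finally show ?thesis .
  qed
  have "\<forall>A\<in>(\<Pi> i\<in>I. ?G). prob (\<Inter>j\<in>I. X j -` A j \<inter> space M) = (\<Prod>j\<in>I. prob (X j -` A j \<inter> space M))"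
  proof
    fix A assume A: "A \<in> (\<Pi> i\<in>I. ?G)"
    have "\<exists>a. X j -` A j \<inter> space M = X j -` {..a} \<inter> space M" if "j \<in> I" for j
    proof (cases "A j = UNIV")
      case True
      \<comment> \<open>As the values lie in [0, 1], {..1} has the same preimage as
        \<open>UNIV\<close>.\<close>
      then show ?thesis using X01[of j] by (intro exI[of _ 1]) auto
    next
      case False
      moreover have "A j \<in> ?G" using A that by (rule Pi_mem)
      ultimately obtain a where "A j = {..a}" by blast
      then show ?thesis by (intro exI[of _ a]) simp
    qed
    then obtain a where a: "\<And>j. j \<in> I \<Longrightarrow> X j -` A j \<inter> space M = X j -` {..a j} \<inter> space M" by metis
    then show "prob (\<Inter>j\<in>I. X j -` A j \<inter> space M) = (\<Prod>j\<in>I. prob (X j -` A j \<inter> space M))"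
      using atMost[of a] by simp
  qed
  then show ?thesis
    using False I X sig
    by (subst indep_vars_finite[where E="\<lambda>_. ?G"]) (auto simp: Int_stable_def)
qed

end

section \<open>The limit is a beta process\<close>

context marked_arrivals
begin

lemma laplace_B:
  assumes "A \<in> sets borel" "0 \<le> t"
  shows "expectation (\<lambda>x. exp (- t * measure (B x) A)) = exp (- measure B0 A * levy_exponent c t)"
  using joint_laplace[of "{()}" "\<lambda>_. A" "\<lambda>_. t"] assms by (simp add: disjoint_family_on_def)

text \<open>A power of exp (- B(A)) is the exponential at an integer argument, so the factorised
  joint Laplace transform is precisely the moment condition of
  \<open>indep_vars_of_moments\<close>.\<close>

lemma indep_B:
  assumes I: "finite I" and d: "disjoint_family_on A I" and A: "\<And>i. i \<in> I \<Longrightarrow> A i \<in> sets borel"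
  shows "indep_vars (\<lambda>_. borel) (\<lambda>i x. measure (B x) (A i)) I"
proof -
  let ?X = "\<lambda>i x. exp (- measure (B x) (A i))"
  have p: "?X i x ^ n = exp (- real n * measure (B x) (A i))" for i x n
    by (simp add: exp_of_nat_mult[symmetric])
  have "indep_vars (\<lambda>_. borel) ?X I"
  proof (rule indep_vars_of_moments[OF I])
    show "?X j \<in> borel_measurable M" if "j \<in> I" for j using A[OF that] by measurable
    show "?X j x \<in> {0..1}" for j x by simp
    show "expectation (\<lambda>x. \<Prod>j\<in>I. ?X j x ^ m j) = (\<Prod>j\<in>I. expectation (\<lambda>x. ?X j x ^ m j))" for m
    proof -
      have "expectation (\<lambda>x. \<Prod>j\<in>I. ?X j x ^ m j) = expectation (\<lambda>x. exp (- (\<Sum>j\<in>I. real (m j) * measure (B x) (A j))))"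
        unfolding p by (simp add: exp_sum[OF I, symmetric] sum_negf)
      also have "\<dots> = exp (- (\<Sum>j\<in>I. measure B0 (A j) * levy_exponent c (real (m j))))"
        by (rule joint_laplace[OF I d A]) auto
      also have "\<dots> = (\<Prod>j\<in>I. exp (- measure B0 (A j) * levy_exponent c (real (m j))))"
        by (simp add: exp_sum[OF I, symmetric] sum_negf)
      also have "\<dots> = (\<Prod>j\<in>I. expectation (\<lambda>x. ?X j x ^ m j))"
        unfolding p by (intro prod.cong refl laplace_B[symmetric] A) auto
      finally show ?thesis .
    qed
  qed
  \<comment> \<open>Independence passes from the exponentials to the masses through y \<mapsto> - ln
    y.\<close>
  then have "indep_vars (\<lambda>_. borel) (\<lambda>i x. - ln (?X i x)) I"
    by (rule indep_vars_compose2[where Y="\<lambda>_ y. - ln y"]) measurable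
  then show ?thesis by simp
qed

lemma beta_process_B: "beta_process M c B0 B"
  unfolding beta_process_def
proof (intro conjI ballI allI impI)
  show "prob_space M" by (rule prob_space_axioms)
  show "sets (B x) = sets borel" for x by (simp add: B_def atom_measure_def)
  show "AE x in M. emeasure (B x) A < \<infinity>" if "A \<in> sets borel" for A
    using AE_arrival_times by eventually_elim (rule measure_B(1)[OF that])
  show "indep_vars (\<lambda>_. borel) (\<lambda>i x. measure (B x) (Aset i)) I"
    if "finite I" "disjoint_family_on Aset I" "\<forall>i\<in>I. Aset i \<in> sets borel" for I :: "nat set" and Aset
    by (rule indep_B) (use that in auto)
  show "(\<integral>x. exp (- t * measure (B x) A) \<partial>M) = exp (- measure B0 A *
      (LBINT s=0..1. (1 - exp (- t * s)) * c * s powr (-1) * (1 - s) powr (c - 1)))"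
    if "A \<in> sets borel" "t \<ge> 0" for A t
    using laplace_B[OF that] by (simp only: levy_exponent_def levy_def)
qed

lemma AE_vague_conv:
  "AE x in M. vague_conv (\<lambda>n. atom_measure (w_n c \<gamma> (\<lambda>i. Gam E i x) n) (\<lambda>i. \<omega> i x)) (B x)"
  using AE_arrival_times unfolding B_def
  by eventually_elim (rule arrival_times.vague_conv_atoms)

end

theorem theorem3:
  fixes M :: "'a measure" and B0 :: "real measure" and c \<gamma> :: real
    and \<omega> E :: "nat \<Rightarrow> 'a \<Rightarrow> real"
  assumes "prob_space M"
    and "sets B0 = sets borel" and "finite_measure B0"
    and "\<And>y. emeasure B0 {y} = 0"
    and "\<gamma> = measure B0 UNIV" and "\<gamma> > 0"
    and "c > 0"
    and "prob_space.indep_vars M (\<lambda>_. borel)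
           (\<lambda>k. case k of Inl i \<Rightarrow> \<omega> i | Inr i \<Rightarrow> E i) (UNIV :: (nat + nat) set)"
    and "\<And>i. distr M borel (\<omega> i) = scale_measure (ennreal (1 / \<gamma>)) B0"
    and "\<And>i. distributed M lborel (E i) (\<lambda>t. ennreal (exponential_density 1 t))"
  shows "(AE x in M. vague_conv
            (\<lambda>n. atom_measure
               (\<lambda>i. if i < n then the_inv_into {0<..<1} (mu_n c \<gamma> n) (Gam E i x / Gam E n x) else 0)
               (\<lambda>i. \<omega> i x))
            (atom_measure (\<lambda>i. the_inv_into {0<..<1} (mu_lim c \<gamma>) (Gam E i x)) (\<lambda>i. \<omega> i x)))
       \<and> beta_process M c B0
           (\<lambda>x. atom_measure (\<lambda>i. the_inv_into {0<..<1} (mu_lim c \<gamma>) (Gam E i x)) (\<lambda>i. \<omega> i x))"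
proof -
  interpret marked_arrivals M B0 c \<gamma> \<omega> E
    using assms unfolding marked_arrivals_def marked_arrivals_axioms_def by simp
  show ?thesis
    using AE_vague_conv beta_process_B by (simp add: B_def[abs_def] w_n_def[abs_def] w_lim_def[abs_def])
qed

end
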